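(* Let $m\ge1$ and let $H>0$ with $H=\mathcal{O}(\varepsilon)$. Suppose that, for some small $\delta>0$, the Jacobian $(DF_m)(h_m(x_0))$ has $M$ eigenvalues $\{\mu_1,\ldots,\mu_M\}$ that lie outside the disk $B(0;1-\delta)$, and that the remaining $N_f-M$ eigenvalues $\{\mu_{M+1},\ldots,\mu_{N_f}\}$ lie inside it. Let $\mathbb{P}$ be the maximal invariant subspace of $(DF_m)(h_m(x_0))$ corresponding to $\{\mu_1,\ldots,\mu_M\}$, let $P$ be the orthogonal projection of $\mathbf{R}^{N_f}$ onto $\mathbb{P}$, and let $Q=I_{N_f}-P$. Given $y^{(1)}$, set $\tilde p^{(1)}=Py^{(1)}$, $\tilde q^{(1)}=Qy^{(1)}$ and, for $r=1,2,\ldots$, $$\tilde p^{(r+1)}=\tilde p^{(r)}+\left[I_M-P\left(DF_m(\tilde p^{(r)}+\tilde q^{(r)})\right)P\right]^{-1}\left(PF_m(\tilde p^{(r)}+\tilde q^{(r)})-\tilde p^{(r)}\right),$$ $$\tilde q^{(r+1)}=QF_m(\tilde p^{(r)}+\tilde q^{(r)}),$$ and $y^{(r)}=\tilde p^{(r)}+\tilde q^{(r)}$. Then this iterative scheme converges to the fixed point $h_m(x_0)$ for all initial guesses $y^{(1)}$ close enough to $h_m(x_0)$.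
   Context: Setting. Consider the fast--slow system $x'=f(x,y,\varepsilon)$, $\varepsilon y'=g(x,y,\varepsilon)$, with $x\in\mathbf{R}^{N_s}$, $y\in\mathbf{R}^{N_f}$, $'=d/dt$, $0<\varepsilon\ll1$ ($\varepsilon$ sufficiently small), where $f,g$ are smooth. On $\{z=(x,y): g(z,0)=0\}$ one assumes $\det (D_yg)(z,0)\neq0$. The system has an $N_s$-dimensional, slow, invariant, normally attracting manifold $\mathcal{L}=\{(x,h(x)): x\in K\}$, $K\subset\mathbf{R}^{N_s}$, where $h$ satisfies $g(x,h(x),\varepsilon)-\varepsilon Dh(x)f(x,h(x),\varepsilon)=0$ and $h=\sum_{i\ge0}\varepsilon^ih_{[i]}$; in particular $g(x,h_{[0]}(x),0)=0$. Normal attractivity means that all eigenvalues of $(D_yg)(x,h_{[0]}(x),0)$ have negative real parts, bounded away from zero uniformly for $x\in K$. Fix $x_0\in K$. For $H>0$, $H=\mathcal{O}(\varepsilon)$ ($H/\varepsilon$ an $\mathcal{O}(1)$ nonzero quantity), the map $F_m:\mathbf{R}^{N_f}\to\mathbf{R}^{N_f}$ is $$F_m(y)=y-(-H)^{m+1}\left(\frac{d^{m+1}y}{dt^{m+1}}\right)(x_0,y),$$ where the time derivative is evaluated at $(x_0,y)$ along solutions of the system. $F_m$ has an isolated fixed point $h_m(x_0)=h(x_0)+\mathcal{O}(\varepsilon^{m+1})$. $B(0;\rho)$ is the open disk of radius $\rho$ in $\mathbf{C}$ centered at the origin; $I_M$ is the identity on $\mathbb{P}$, and the bracketed operator in the first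 recursion acts on $\mathbb{P}$. (The scheme is Newton iteration on $\tilde p=PF_m(\tilde p+\tilde q)$ combined with functional iteration on $\tilde q=QF_m(\tilde p+\tilde q)$.) *)

theory Defs
  imports "HOL-Analysis.Analysis" "HOL-Library.Landau_Symbols"
begin

section \<open>Smooth functions\<close>

text \<open>Intended for open sets \<open>S\<close> only.\<close>

primrec Ck_on :: "nat \<Rightarrow> ('a::euclidean_space \<Rightarrow> 'b::euclidean_space) \<Rightarrow> 'a set \<Rightarrow> bool" where
  "Ck_on 0 F S \<longleftrightarrow> continuous_on S F"
| "Ck_on (Suc k) F S \<longleftrightarrow>
     F differentiable_on S \<and> (\<forall>v. Ck_on k (\<lambda>x. frechet_derivative F (at x) v) S)"

definition smooth_on :: "('a::euclidean_space \<Rightarrow> 'b::euclidean_space) \<Rightarrow> 'a set \<Rightarrow> bool" where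
  "smooth_on F S \<longleftrightarrow> (\<forall>k. Ck_on k F S)"

section \<open>Eigenvalues and invariant subspaces of real matrices\<close>

abbreviation complexify :: "real^'n^'m \<Rightarrow> complex^'n^'m" where
  "complexify A \<equiv> map_matrix complex_of_real A"

text \<open>
  \<open>c\<close> is a (complex) eigenvalue of the restriction of \<open>A\<close> to the real subspace \<open>V\<close>: the
  eigenvector is taken in the complexification \<open>V + \<i> V\<close>.
\<close>

definition eigenvalue_on :: "real^'n^'n \<Rightarrow> (real^'n) set \<Rightarrow> complex \<Rightarrow> bool" where
  "eigenvalue_on A V c \<longleftrightarrow>
     (\<exists>w::complex^'n. w \<noteq> 0 \<and> (\<chi> i. Re (w $ i)) \<in> V \<and> (\<chi> i. Im (w $ i)) \<in> V \<and>
        complexify A *v w = c *s w)"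

text \<open>
  \<open>\<mu> 1, \<dots>, \<mu> n\<close> lists all complex eigenvalues of \<open>A\<close>, each as often as its multiplicity as a
  root of the characteristic polynomial.
\<close>

definition spectrum_enum :: "real^'n^'n \<Rightarrow> (nat \<Rightarrow> complex) \<Rightarrow> bool" where
  "spectrum_enum A \<mu> \<longleftrightarrow>
     (\<forall>z. det (mat z - complexify A) = (\<Prod>i\<in>{1..CARD('n)}. z - \<mu> i))"

definition invariant_subspace_for ::
    "real^'n^'n \<Rightarrow> complex set \<Rightarrow> (real^'n) set \<Rightarrow> bool" where
  "invariant_subspace_for A \<Sigma> V \<longleftrightarrow>
     subspace V \<and> (\<forall>v\<in>V. A *v v \<in> V) \<and> (\<forall>c. eigenvalue_on A V c \<longrightarrow> c \<in> \<Sigma>)"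

definition maximal_invariant_subspace ::
    "real^'n^'n \<Rightarrow> complex set \<Rightarrow> (real^'n) set \<Rightarrow> bool" where
  "maximal_invariant_subspace A \<Sigma> V \<longleftrightarrow>
     invariant_subspace_for A \<Sigma> V \<and>
     (\<forall>W. invariant_subspace_for A \<Sigma> W \<and> V \<subseteq> W \<longrightarrow> W = V)"

definition orth_projection :: "(real^'n) set \<Rightarrow> real^'n \<Rightarrow> real^'n" where
  "orth_projection V y = (THE p. p \<in> V \<and> (\<forall>v\<in>V. orthogonal (y - p) v))"

section \<open>Fast--slow systems\<close>

definition fast_slow_system ::
    "(real^'s \<Rightarrow> real^'f \<Rightarrow> real \<Rightarrow> real^'s) \<Rightarrow> (real^'s \<Rightarrow> real^'f \<Rightarrow> real \<Rightarrow> real^'f) \<Rightarrow> real \<Rightarrow> bool"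
  where
  "fast_slow_system f g \<epsilon>\<^sub>1 \<longleftrightarrow>
     0 < \<epsilon>\<^sub>1 \<and>
     smooth_on (\<lambda>(x, y, \<epsilon>). f x y \<epsilon>) (UNIV \<times> UNIV \<times> {-\<epsilon>\<^sub>1<..<\<epsilon>\<^sub>1}) \<and>
     smooth_on (\<lambda>(x, y, \<epsilon>). g x y \<epsilon>) (UNIV \<times> UNIV \<times> {-\<epsilon>\<^sub>1<..<\<epsilon>\<^sub>1}) \<and>
     (\<forall>x y. g x y 0 = 0 \<longrightarrow> det (jacobian (\<lambda>y. g x y 0) (at y)) \<noteq> 0)"

definition solution_on ::
    "(real^'s \<Rightarrow> real^'f \<Rightarrow> real \<Rightarrow> real^'s) \<Rightarrow> (real^'s \<Rightarrow> real^'f \<Rightarrow> real \<Rightarrow> real^'f) \<Rightarrow> real \<Rightarrow>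
     real set \<Rightarrow> (real \<Rightarrow> real^'s) \<Rightarrow> (real \<Rightarrow> real^'f) \<Rightarrow> bool"
  where
  "solution_on f g \<epsilon> T X Y \<longleftrightarrow>
     (\<forall>t\<in>T. (X has_vector_derivative f (X t) (Y t) \<epsilon>) (at t) \<and>
        Y differentiable (at t) \<and> \<epsilon> *\<^sub>R vector_derivative Y (at t) = g (X t) (Y t) \<epsilon>)"

text \<open>
  The manifold at parameter \<open>\<epsilon>\<close> is the graph of \<open>h \<epsilon>\<close> over \<open>K\<close>, and \<open>hc i\<close> is the coefficient
  \<open>h\<^bsub>[i]\<^esub>\<close> of the (asymptotic) expansion of \<open>h\<close> in powers of \<open>\<epsilon>\<close>. No shape of \<open>K\<close> is
  prescribed, so \<open>Dh\<close> is a derivative within \<open>K\<close>; the expansion is only required pointwise on \<open>K\<close>.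
\<close>

definition slow_manifold ::
    "(real^'s \<Rightarrow> real^'f \<Rightarrow> real \<Rightarrow> real^'s) \<Rightarrow> (real^'s \<Rightarrow> real^'f \<Rightarrow> real \<Rightarrow> real^'f) \<Rightarrow> real \<Rightarrow>
     (real^'s) set \<Rightarrow> (real \<Rightarrow> real^'s \<Rightarrow> real^'f) \<Rightarrow> (nat \<Rightarrow> real^'s \<Rightarrow> real^'f) \<Rightarrow> bool"
  where
  "slow_manifold f g \<epsilon>\<^sub>1 K h hc \<longleftrightarrow>
     (\<forall>\<epsilon>\<in>{0<..<\<epsilon>\<^sub>1}. \<forall>x\<in>K. \<exists>Dh. (h \<epsilon> has_derivative Dh) (at x within K) \<and>
        g x (h \<epsilon> x) \<epsilon> - \<epsilon> *\<^sub>R Dh (f x (h \<epsilon> x) \<epsilon>) = 0) \<and>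
     (\<forall>x\<in>K. \<forall>n. (\<lambda>\<epsilon>. norm (h \<epsilon> x - (\<Sum>i\<le>n. \<epsilon> ^ i *\<^sub>R hc i x))) \<in> O[at_right 0](\<lambda>\<epsilon>. \<epsilon> ^ (n + 1))) \<and>
     (\<forall>x\<in>K. g x (hc 0 x) 0 = 0)"

definition normally_attracting ::
    "(real^'s \<Rightarrow> real^'f \<Rightarrow> real \<Rightarrow> real^'f) \<Rightarrow> (real^'s) set \<Rightarrow> (real^'s \<Rightarrow> real^'f) \<Rightarrow> bool"
  where
  "normally_attracting g K h\<^sub>0 \<longleftrightarrow>
     (\<exists>\<beta>>0. \<forall>x\<in>K. \<forall>c. eigenvalue_on (jacobian (\<lambda>y. g x y 0) (at (h\<^sub>0 x))) UNIV c \<longrightarrow> Re c \<le> - \<beta>)"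

section \<open>The map \<open>F\<^sub>m\<close> and the iterative scheme\<close>

text \<open>
  \<open>d\<^sup>k y / dt\<^sup>k\<close> at \<open>(x\<^sub>0, y\<^sub>0)\<close> along solutions: the \<open>k\<close>-th derivative at \<open>t = 0\<close> of the fast
  component of a local solution through \<open>(x\<^sub>0, y\<^sub>0)\<close>; the value is the same for all such solutions.
\<close>

definition time_derivative ::
    "(real^'s \<Rightarrow> real^'f \<Rightarrow> real \<Rightarrow> real^'s) \<Rightarrow> (real^'s \<Rightarrow> real^'f \<Rightarrow> real \<Rightarrow> real^'f) \<Rightarrow> real \<Rightarrow>
     nat \<Rightarrow> real^'s \<Rightarrow> real^'f \<Rightarrow> real^'f"
  where
  "time_derivative f g \<epsilon> k x\<^sub>0 y\<^sub>0 =
     (THE d. \<exists>\<tau>>0. \<exists>X Y. solution_on f g \<epsilon> {-\<tau><..<\<tau>} X Y \<and> X 0 = x\<^sub>0 \<and> Y 0 = y\<^sub>0 \<and>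
        d = ((\<lambda>Z t. vector_derivative Z (at t)) ^^ k) Y 0)"

definition Fmap ::
    "(real^'s \<Rightarrow> real^'f \<Rightarrow> real \<Rightarrow> real^'s) \<Rightarrow> (real^'s \<Rightarrow> real^'f \<Rightarrow> real \<Rightarrow> real^'f) \<Rightarrow> real \<Rightarrow>
     real \<Rightarrow> nat \<Rightarrow> real^'s \<Rightarrow> real^'f \<Rightarrow> real^'f"
  where
  "Fmap f g \<epsilon> H m x\<^sub>0 y = y - ((- H) ^ (m + 1)) *\<^sub>R time_derivative f g \<epsilon> (m + 1) x\<^sub>0 y"

definition newton_op :: "(real^'n \<Rightarrow> real^'n) \<Rightarrow> (real^'n) set \<Rightarrow> real^'n \<Rightarrow> real^'n \<Rightarrow> real^'n" where
  "newton_op F V y v = v - orth_projection V (jacobian F (at y) *v orth_projection V v)"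

text \<open>
  The bracketed operator is inverted as a map from \<open>V\<close> to \<open>V\<close>. Only the values of \<open>p\<close> and \<open>q\<close>
  at indices \<open>r \<ge> 1\<close> matter.
\<close>

definition newton_picard_iteration ::
    "(real^'n \<Rightarrow> real^'n) \<Rightarrow> (real^'n) set \<Rightarrow> real^'n \<Rightarrow> (nat \<Rightarrow> real^'n) \<Rightarrow> (nat \<Rightarrow> real^'n) \<Rightarrow> bool"
  where
  "newton_picard_iteration F V y\<^sub>1 p q \<longleftrightarrow>
     (let P = orth_projection V; Q = (\<lambda>v. v - P v) in
      p 1 = P y\<^sub>1 \<and> q 1 = Q y\<^sub>1 \<and>
      (\<forall>r\<ge>1. p (r + 1) = p r + inv_into V (newton_op F V (p r + q r)) (P (F (p r + q r)) - p r) \<and>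
             q (r + 1) = Q (F (p r + q r))))"

end

theory Submission
  imports Defs "HOL-Computational_Algebra.Fundamental_Theorem_Algebra"
begin

text \<open>
  Near its fixed point \<open>z = hm \<epsilon>\<close> the scheme is linearized. With \<open>J\<close> the Jacobian of \<open>F\<^sub>m\<close> at \<open>z\<close> and
  \<open>e\<close> the error, Newton's method on \<open>V\<close> removes the component \<open>P e\<close> to first order, while functional
  iteration multiplies \<open>Q e\<close> by \<open>Q J Q\<close>. The linear part of a step is thus block triangular with diagonal
  blocks \<open>0\<close> and \<open>Q J Q\<close>, and it suffices to know that the powers of \<open>Q J Q\<close> tend to zero and that the Newton
  operator is invertible at \<open>z\<close>; this is \<open>newton_picard_converges\<close>, which rests on the stability lemma
  \<open>local_stability\<close> for sequences that follow a linear map up to a small relative error.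

  The powers of \<open>Q J Q\<close> tend to zero because all its eigenvalues lie in the disk of radius \<open>1 - \<delta>\<close>
  (\<open>compression_powers_tendsto_zero\<close>): an eigenvalue outside would be an eigenvalue of \<open>J\<close> modulo \<open>V\<close>, and \<open>V\<close>
  could be enlarged within the class of invariant subspaces for the outer eigenvalues
  (\<open>maximal_invariant_quotient\<close>).

  Invertibility of the Newton operator is where the fast--slow structure enters, since the spectral
  hypothesis alone does not prevent \<open>1\<close> from being one of the outer eigenvalues. In the fast time the
  \<open>(m+1)\<close>-st derivative of \<open>y\<close> is an iterated Lie derivative that is jointly smooth in \<open>(x, y, \<epsilon>)\<close>, also
  at \<open>\<epsilon> = 0\<close>, and its \<open>y\<close>-derivative on the critical manifold is \<open>B\<^bsup>m+1\<^esup>\<close> with \<open>B = D\<^sub>y g\<close>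
  (\<open>fast_deriv_at_critical_point\<close>). Hence
  \<open>I - J = (- H / \<epsilon>)\<^bsup>m+1\<^esup> (B\<^bsup>m+1\<^esup> + o(1))\<close>, which is invertible for small \<open>\<epsilon>\<close> because \<open>B\<close> is.

  That \<open>F\<^sub>m\<close> is given by this Lie derivative, and so is continuously differentiable, requires that solutions
  through every point exist, which is proved by Picard iteration (\<open>ode_local_existence\<close>).
\<close>

section \<open>Powers of a matrix of small spectral radius\<close>

lemma affine_recurrence_tendsto_zero:
  fixes x y :: "nat \<Rightarrow> 'a::real_normed_field"
  assumes rec: "\<And>k. x (Suc k) = c * x k + y k" and c: "norm c < 1" and y: "y \<longlonglongrightarrow> 0"
  shows "x \<longlonglongrightarrow> 0"
proof (rule LIMSEQ_I)
  fix r :: real assume r: "0 < r"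
  define s where "s = (r / 2) * (1 - norm c)"
  have s: "s > 0" using r c by (simp add: s_def)
  from LIMSEQ_D[OF y s] obtain N where N: "\<And>n. n \<ge> N \<Longrightarrow> norm (y n) < s" by auto
  have bound: "norm (x (N + j)) \<le> r / 2 + norm c ^ j * norm (x N)" for j
  proof (induction j)
    case 0
    then show ?case using r by simp
  next
    case (Suc j)
    have "norm (x (N + Suc j)) \<le> norm c * norm (x (N + j)) + norm (y (N + j))"
      using norm_triangle_ineq[of "c * x (N + j)" "y (N + j)"] by (simp add: rec norm_mult)
    also have "\<dots> \<le> norm c * (r / 2 + norm c ^ j * norm (x N)) + s"
      using Suc N[of "N + j"] by (intro add_mono mult_left_mono) auto
    also have "\<dots> = r / 2 + norm c ^ Suc j * norm (x N)"
      by (simp add: s_def field_simps)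
    finally show ?case .
  qed
  have "(\<lambda>j. norm c ^ j * norm (x N)) \<longlonglongrightarrow> 0 * norm (x N)"
    using c by (intro tendsto_mult tendsto_const LIMSEQ_power_zero) simp
  then have "(\<lambda>j. norm c ^ j * norm (x N)) \<longlonglongrightarrow> 0" by simp
  from LIMSEQ_D[OF this, of "r / 2"] r
  obtain M where M: "\<And>j. j \<ge> M \<Longrightarrow> \<bar>norm c ^ j * norm (x N)\<bar> < r / 2" by auto
  show "\<exists>no. \<forall>n\<ge>no. norm (x n - 0) < r"
  proof (intro exI[of _ "N + M"] allI impI)
    fix n assume "n \<ge> N + M"
    then have "n = N + (n - N)" "n - N \<ge> M" by auto
    then show "norm (x n - 0) < r" using bound[of "n - N"] M[of "n - N"] by simp
  qed
qed

text \<open>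
  The vector \<open>p(A) u\<close>, evaluated by Horner's rule. Only orbits of single vectors are followed, so the
  matrix \<open>p(A)\<close> itself is never formed.
\<close>

definition poly_apply :: "complex^'n^'n \<Rightarrow> complex poly \<Rightarrow> complex^'n \<Rightarrow> complex^'n" where
  "poly_apply A p u = fold_coeffs (\<lambda>a w. a *s u + A *v w) p 0"

lemma poly_apply_0 [simp]: "poly_apply A 0 u = 0"
  by (simp add: poly_apply_def)

lemma poly_apply_pCons [simp]: "poly_apply A (pCons a p) u = a *s u + A *v poly_apply A p u"
  by (cases "p = 0 \<and> a = 0") (auto simp: poly_apply_def)

lemma poly_apply_add: "poly_apply A (p + q) u = poly_apply A p u + poly_apply A q u"
  by (induction p q rule: poly_induct2)
    (auto simp: matrix_vector_right_distrib vector_sadd_rdistrib algebra_simps)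

lemma poly_apply_smult: "poly_apply A (smult c p) u = c *s poly_apply A p u"
  by (induction p) (auto simp: vector_scalar_commute vector_add_ldistrib)

lemma poly_apply_linear_factor:
  "poly_apply A ([:- c, 1:] * q) u = A *v poly_apply A q u - c *s poly_apply A q u"
proof -
  have eq: "[:- c, 1:] * q = smult (- c) q + pCons 0 q" by simp
  show ?thesis
    unfolding eq poly_apply_add poly_apply_smult poly_apply_pCons
    by (simp only: vec_eq_iff vector_add_component vector_minus_component
      vector_smult_component) simp
qed

lemma poly_apply_commutes_linear_factor:
  "poly_apply A q (A *v u - c *s u) = A *v poly_apply A q u - c *s poly_apply A q u"
proof (induction q)
  case 0
  then show ?case by simp
next
  case (pCons a q)
  show ?case
    by (simp only: poly_apply_pCons pCons.IH)
      (simp only: vec.diff vec.add vec.scale vec_eq_iff vector_add_component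
        vector_minus_component vector_smult_component, simp add: algebra_simps)
qed

lemma poly_apply_monom: "poly_apply A (monom 1 k) u = ((*v) A ^^ k) u"
  by (induction k) (auto simp: monom_Suc monom_0)

lemma exists_annihilating_poly:
  fixes A :: "complex^'n^'n"
  shows "\<exists>p. p \<noteq> 0 \<and> poly_apply A p u = 0"
proof -
  define a where "a k = ((*v) A ^^ k) u" for k
  \<comment> \<open>Otherwise the first \<open>DIM + 1\<close> iterates would be independent.\<close>
  have "\<exists>k. a k \<in> span (a ` {..<k})"
  proof (rule ccontr)
    assume "\<nexists>k. a k \<in> span (a ` {..<k})"
    then have notin: "a k \<notin> span (a ` {..<k})" for k by auto
    have indep: "independent (a ` {..<k}) \<and> card (a ` {..<k}) = k" for k
    proof (induction k)
      case 0
      show ?case by (simp add: independent_empty)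
    next
      case (Suc k)
      have new: "a k \<notin> a ` {..<k}" using notin[of k] span_base[of "a k" "a ` {..<k}"] by metis
      have eq: "a ` {..<Suc k} = insert (a k) (a ` {..<k})" by (simp add: lessThan_Suc)
      have "independent (insert (a k) (a ` {..<k}))"
        using Suc notin[of k] by (intro independent_insertI) auto
      moreover have "card (insert (a k) (a ` {..<k})) = Suc k"
        using Suc new by (subst card_insert_disjoint) auto
      ultimately show ?case unfolding eq by blast
    qed
    have "card (a ` {..<Suc DIM(complex^'n)}) \<le> DIM(complex^'n)"
      by (rule independent_bound[OF indep[THEN conjunct1], THEN conjunct2])
    then show False using indep[of "Suc DIM(complex^'n)"] by linarith
  qed
  then obtain k where k: "a k \<in> span (a ` {..<k})" by auto
  define U where "U = {w. \<exists>q. (\<forall>i\<ge>k. coeff q i = 0) \<and> w = poly_apply A q u}"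
  have "subspace U"
    unfolding subspace_def
  proof (intro conjI ballI allI)
    show "0 \<in> U" by (auto simp: U_def intro!: exI[of _ 0])
  next
    fix x y assume "x \<in> U" "y \<in> U"
    then obtain q r where "\<forall>i\<ge>k. coeff q i = 0" "x = poly_apply A q u"
      "\<forall>i\<ge>k. coeff r i = 0" "y = poly_apply A r u" by (auto simp: U_def)
    then show "x + y \<in> U" by (auto simp: U_def poly_apply_add intro!: exI[of _ "q + r"])
  next
    fix c :: real and x assume "x \<in> U"
    then obtain q where q: "\<forall>i\<ge>k. coeff q i = 0" "x = poly_apply A q u" by (auto simp: U_def)
    have "c *\<^sub>R x = complex_of_real c *s x"
      unfolding vec_eq_iff vector_scaleR_component vector_smult_component
      by (simp add: scaleR_conv_of_real)
    then show "c *\<^sub>R x \<in> U" using q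
      by (auto simp: U_def poly_apply_smult intro!: exI[of _ "smult (of_real c) q"])
  qed
  moreover have "a i \<in> U" if "i < k" for i
    unfolding U_def using that
    by (intro CollectI exI[of _ "monom 1 i"]) (simp add: a_def poly_apply_monom)
  then have "a ` {..<k} \<subseteq> U" by blast
  ultimately have "a k \<in> U" using k span_minimal by blast
  then obtain q where q: "\<forall>i\<ge>k. coeff q i = 0" "a k = poly_apply A q u" by (auto simp: U_def)
  have "coeff (monom 1 k + smult (-1) q) k = 1" using q(1) by simp
  then have nz: "monom 1 k + smult (-1) q \<noteq> 0" by (metis coeff_0 zero_neq_one)
  have "poly_apply A (monom 1 k) u = poly_apply A q u"
    using q(2) by (simp only: poly_apply_monom a_def)
  then have "poly_apply A (monom 1 k + smult (-1) q) u = 0"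
    unfolding poly_apply_add poly_apply_smult
    by (simp only: vec_eq_iff vector_add_component vector_smult_component) simp
  with nz show ?thesis by blast
qed

text \<open>
  Induction on the degree of a polynomial \<open>p\<close> with \<open>p(A) u = 0\<close>. Over the complex numbers
  \<open>p = (z - c) q\<close>. Either \<open>q(A) u = 0\<close> already, or \<open>q(A) u\<close> is an eigenvector for \<open>c\<close> and so
  \<open>\<bar>c\<bar> < 1\<close>. In the second case \<open>q\<close> annihilates \<open>(A - c) u\<close>, so \<open>A\<^sup>k u\<close> solves the scalar
  recurrence \<open>x\<^bsub>k+1\<^esub> = c x\<^bsub>k\<^esub> + y\<^bsub>k\<^esub>\<close> with \<open>y\<^bsub>k\<^esub>\<close> tending to zero. This avoids normal forms and the
  Cayley--Hamilton theorem.
\<close>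

lemma spectral_radius_powers_tendsto_zero:
  fixes A :: "complex^'n^'n"
  assumes ev: "\<And>c w. w \<noteq> 0 \<Longrightarrow> A *v w = c *s w \<Longrightarrow> cmod c < 1"
  shows "(\<lambda>k. ((*v) A ^^ k) u) \<longlonglongrightarrow> 0"
proof -
  have "(\<lambda>k. ((*v) A ^^ k) u) \<longlonglongrightarrow> 0" if "p \<noteq> 0" "poly_apply A p u = 0" for p u
    using that
  proof (induction "degree p" arbitrary: p u rule: less_induct)
    case less
    show ?case
    proof (cases "degree p = 0")
      case True
      then obtain a where "p = [:a:]" using degree_eq_zeroE by blast
      with less.prems have "u = 0" by (auto simp: vec_eq_iff)
      have "((*v) A ^^ k) 0 = 0" for k by (induction k) auto
      with \<open>u = 0\<close> show ?thesis by simp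
    next
      case False
      then obtain c where "poly p c = 0"
        using fundamental_theorem_of_algebra[of p] constant_degree[of p] by auto
      then obtain q where p: "p = [:- c, 1:] * q" by (auto simp: poly_eq_0_iff_dvd)
      with less.prems have q0: "q \<noteq> 0" by auto
      then have deg: "degree q < degree p"
        unfolding p by (subst degree_mult_eq) auto
      have root: "A *v poly_apply A q u - c *s poly_apply A q u = 0"
        using less.prems by (simp only: p poly_apply_linear_factor)
      show ?thesis
      proof (cases "poly_apply A q u = 0")
        case True
        then show ?thesis using less.hyps deg q0 by blast
      next
        case False
        then have c: "cmod c < 1" using ev root by auto
        have "poly_apply A q (A *v u - c *s u) = 0"
          using root by (simp only: poly_apply_commutes_linear_factor)
        then have lim: "(\<lambda>k. ((*v) A ^^ k) (A *v u - c *s u)) \<longlonglongrightarrow> 0"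
          using less.hyps deg q0 by blast
        have diff: "((*v) A ^^ k) (A *v u - c *s u)
            = ((*v) A ^^ Suc k) u - c *s ((*v) A ^^ k) u" for k
          by (induction k) (auto simp: vec.diff vec.scale)
        show ?thesis
        proof (rule vec_tendstoI)
          fix i
          have "(\<lambda>k. ((*v) A ^^ k) (A *v u - c *s u) $ i) \<longlonglongrightarrow> 0 $ i"
            by (rule tendsto_vec_nth[OF lim])
          then have "(\<lambda>k. ((*v) A ^^ k) (A *v u - c *s u) $ i) \<longlonglongrightarrow> 0" by simp
          then have "(\<lambda>k. ((*v) A ^^ k) u $ i) \<longlonglongrightarrow> 0"
            by (rule affine_recurrence_tendsto_zero[OF _ c, rotated]) (simp add: diff)
          then show "(\<lambda>k. ((*v) A ^^ k) u $ i) \<longlonglongrightarrow> 0 $ i" by simp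
        qed
      qed
    qed
  qed
  then show ?thesis using exists_annihilating_poly[of A u] by blast
qed

section \<open>Local stability from the linear part\<close>

text \<open>
  A crude operator norm. Unlike \<open>onorm\<close> it is a finite sum of norms of values of \<open>T\<close>, so that pointwise
  convergence of linear maps gives convergence in norm at once.
\<close>

lemma linear_norm_le_sum_Basis:
  fixes T :: "'a::euclidean_space \<Rightarrow> 'b::real_normed_vector"
  assumes "linear T"
  shows "norm (T x) \<le> norm x * (\<Sum>b\<in>Basis. norm (T b))"
proof -
  interpret linear T by fact
  have "T x = T (\<Sum>b\<in>Basis. (x \<bullet> b) *\<^sub>R b)" by (simp add: euclidean_representation)
  also have "\<dots> = (\<Sum>b\<in>Basis. (x \<bullet> b) *\<^sub>R T b)" by (simp add: sum scale)
  also have "norm \<dots> \<le> (\<Sum>b\<in>Basis. norm ((x \<bullet> b) *\<^sub>R T b))" by (rule norm_sum)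
  also have "\<dots> \<le> (\<Sum>b\<in>Basis. norm x * norm (T b))"
    by (intro sum_mono) (simp add: mult_right_mono Basis_le_norm)
  finally show ?thesis by (simp add: sum_distrib_left)
qed

lemma linear_funpow:
  fixes L :: "'a::real_vector \<Rightarrow> 'a"
  shows "linear L \<Longrightarrow> linear (L ^^ k)"
  by (induction k) (simp_all add: linear_id linear_compose del: id_apply)

text \<open>
  Pointwise decay of the powers makes some power \<open>L\<^sup>N\<close> halve all norms; the sum of the norms of
  \<open>x, L x, \<dots>, L\<^bsup>N-1\<^esup> x\<close> is then contracted by \<open>L\<close> itself.
\<close>

lemma adapted_norm:
  fixes L :: "'a::euclidean_space \<Rightarrow> 'a"
  assumes L: "linear L" and pow: "\<And>x. (\<lambda>k. (L ^^ k) x) \<longlonglongrightarrow> 0"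
  obtains \<nu> :: "'a \<Rightarrow> real" and \<theta> C :: real
  where "0 \<le> \<theta>" "\<theta> < 1" "1 \<le> C" "\<And>x. norm x \<le> \<nu> x" "\<And>x. \<nu> x \<le> C * norm x"
    "\<And>x y. \<nu> (x + y) \<le> \<nu> x + \<nu> y" "\<And>x. \<nu> (L x) \<le> \<theta> * \<nu> x"
proof -
  have lin: "linear (L ^^ k)" for k using linear_funpow[OF L] .
  have "(\<lambda>k. \<Sum>b\<in>Basis. norm ((L ^^ k) b)) \<longlonglongrightarrow> (\<Sum>b\<in>(Basis::'a set). 0)"
    by (intro tendsto_sum tendsto_norm_zero pow)
  from LIMSEQ_D[OF this, of "1/2"] obtain N0
    where N0: "\<bar>\<Sum>b\<in>(Basis::'a set). norm ((L ^^ k) b)\<bar> < 1/2" if "k \<ge> N0" for k by auto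
  define N where "N = Suc N0"
  have half: "norm ((L ^^ N) x) \<le> norm x / 2" for x
  proof -
    have "norm ((L ^^ N) x) \<le> norm x * (\<Sum>b\<in>Basis. norm ((L ^^ N) b))"
      by (rule linear_norm_le_sum_Basis[OF lin])
    also have "\<dots> \<le> norm x * (1/2)"
      using N0[of N] by (intro mult_left_mono) (auto simp: N_def)
    finally show ?thesis by simp
  qed
  \<comment> \<open>Passing from \<open>x\<close> to \<open>L x\<close> trades the first summand for one of at most half its size.\<close>
  define \<nu> where "\<nu> x = (\<Sum>k<N. norm ((L ^^ k) x))" for x
  define C where "C = 1 + (\<Sum>k<N. \<Sum>b\<in>(Basis::'a set). norm ((L ^^ k) b))"
  have C: "1 \<le> C" by (auto simp: C_def intro!: sum_nonneg)
  have lower: "norm x \<le> \<nu> x" for x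
    unfolding \<nu>_def N_def by (subst sum.lessThan_Suc_shift) (auto intro!: sum_nonneg)
  have upper: "\<nu> x \<le> C * norm x" for x
  proof -
    have "\<nu> x \<le> (\<Sum>k<N. norm x * (\<Sum>b\<in>Basis. norm ((L ^^ k) b)))"
      unfolding \<nu>_def by (intro sum_mono linear_norm_le_sum_Basis lin)
    also have "\<dots> = norm x * (C - 1)" by (simp add: C_def sum_distrib_left)
    also have "\<dots> \<le> norm x * C" by (intro mult_left_mono) auto
    finally show ?thesis by (simp add: mult.commute)
  qed
  have "\<nu> (x + y) \<le> \<nu> x + \<nu> y" for x y
    unfolding \<nu>_def sum.distrib[symmetric]
    by (intro sum_mono) (simp add: linear_add[OF lin] norm_triangle_ineq)
  moreover have "\<nu> (L x) \<le> (1 - 1 / (2 * C)) * \<nu> x" for x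
  proof -
    have "norm x + \<nu> (L x) = (\<Sum>k<Suc N. norm ((L ^^ k) x))"
      unfolding \<nu>_def
      by (subst sum.lessThan_Suc_shift) (simp add: funpow_Suc_right del: funpow.simps)
    also have "\<dots> = \<nu> x + norm ((L ^^ N) x)" by (simp add: \<nu>_def)
    finally have "\<nu> (L x) \<le> \<nu> x - norm x / 2" using half[of x] by simp
    moreover have "\<nu> x / (2 * C) \<le> norm x / 2"
      using upper[of x] C by (simp add: field_simps)
    ultimately show ?thesis by (simp add: algebra_simps)
  qed
  moreover have "0 \<le> 1 - 1 / (2 * C)" "1 - 1 / (2 * C) < 1" using C by auto
  ultimately show thesis using that C lower upper by blast
qed

text \<open>
  The iteration is only known to act as \<open>L\<close> plus a small error on iterates that are close to the fixed
  point and satisfy an invariant \<open>I\<close> (here: a Newton step is solvable, and the components lie in the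
  right subspaces). Closeness, the invariant and convergence therefore have to be proved together. In the
  adapted norm each step contracts, so the iterates never leave the ball of radius \<open>d\<close>. The tolerance
  \<open>\<eta>\<close> depends on \<open>L\<close> alone, and so may be fixed before \<open>d\<close> is chosen.
\<close>

lemma local_stability:
  fixes L :: "'a::euclidean_space \<Rightarrow> 'a"
  assumes L: "linear L" and pow: "\<And>x. (\<lambda>k. (L ^^ k) x) \<longlonglongrightarrow> 0"
  shows "\<exists>\<eta>>0. \<forall>d>0. \<exists>\<rho>>0. \<forall>(e::nat \<Rightarrow> 'a) I.
    norm (e 0) < \<rho> \<and> I 0 \<and>
    (\<forall>r. I r \<and> norm (e r) < d \<longrightarrow> I (Suc r) \<and> norm (e (Suc r) - L (e r)) \<le> \<eta> * norm (e r)) \<longrightarrow>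
    (\<forall>r. I r \<and> norm (e r) < d) \<and> e \<longlonglongrightarrow> 0"
proof -
  from adapted_norm[OF assms] obtain \<nu> :: "'a \<Rightarrow> real" and \<theta> C
    where \<theta>: "0 \<le> \<theta>" "\<theta> < 1" and C: "1 \<le> C" and lower: "\<And>x. norm x \<le> \<nu> x"
    and upper: "\<And>x. \<nu> x \<le> C * norm x" and sub: "\<And>x y. \<nu> (x + y) \<le> \<nu> x + \<nu> y"
    and contr: "\<And>x. \<nu> (L x) \<le> \<theta> * \<nu> x" by metis
  define \<eta> where "\<eta> = (1 - \<theta>) / (2 * C)"
  define \<theta>' where "\<theta>' = (1 + \<theta>) / 2"
  have \<eta>: "\<eta> > 0" using \<theta> C by (simp add: \<eta>_def)
  have \<theta>': "0 \<le> \<theta>'" "\<theta>' < 1" using \<theta> by (auto simp: \<theta>'_def)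
  have pos: "0 \<le> \<nu> x" for x using lower[of x] norm_ge_zero order_trans by blast
  show ?thesis
  proof (rule exI[of _ \<eta>], intro conjI \<eta> allI impI)
    fix d :: real assume d: "0 < d"
    show "\<exists>\<rho>>0. \<forall>e I. norm (e 0) < \<rho> \<and> I 0 \<and>
      (\<forall>r. I r \<and> norm (e r) < d \<longrightarrow> I (Suc r) \<and> norm (e (Suc r) - L (e r)) \<le> \<eta> * norm (e r)) \<longrightarrow>
      (\<forall>r. I r \<and> norm (e r) < d) \<and> e \<longlonglongrightarrow> 0"
    proof (rule exI[of _ "d / C"], intro conjI)
      show "d / C > 0" using d C by simp
      show "\<forall>e I. norm (e 0) < d / C \<and> I 0 \<and>
        (\<forall>r. I r \<and> norm (e r) < d \<longrightarrow>
          I (Suc r) \<and> norm (e (Suc r) - L (e r)) \<le> \<eta> * norm (e r)) \<longrightarrow>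
        (\<forall>r. I r \<and> norm (e r) < d) \<and> e \<longlonglongrightarrow> 0"
      proof (intro allI impI)
        fix e :: "nat \<Rightarrow> 'a" and I
        assume "norm (e 0) < d / C \<and> I 0 \<and>
          (\<forall>r. I r \<and> norm (e r) < d \<longrightarrow>
            I (Suc r) \<and> norm (e (Suc r) - L (e r)) \<le> \<eta> * norm (e r))"
        then have e0: "norm (e 0) < d / C" and I0: "I 0"
          and step: "\<And>r. I r \<Longrightarrow> norm (e r) < d \<Longrightarrow>
            I (Suc r) \<and> norm (e (Suc r) - L (e r)) \<le> \<eta> * norm (e r)" by auto
        have \<nu>0: "\<nu> (e 0) < d"
          using upper[of "e 0"] e0 C by (simp add: field_simps)
        have inv: "I r \<and> \<nu> (e r) \<le> \<theta>' ^ r * \<nu> (e 0)" for r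
        proof (induction r)
          case 0
          then show ?case using I0 by simp
        next
          case (Suc r)
          have "\<theta>' ^ r * \<nu> (e 0) \<le> 1 * \<nu> (e 0)"
            using \<theta>' pos by (intro mult_right_mono power_le_one) auto
          with Suc lower[of "e r"] \<nu>0 have small: "norm (e r) < d" by simp
          from step[OF _ small] Suc have I: "I (Suc r)"
            and est: "norm (e (Suc r) - L (e r)) \<le> \<eta> * norm (e r)" by auto
          have "\<nu> (e (Suc r)) \<le> \<nu> (L (e r)) + \<nu> (e (Suc r) - L (e r))"
            using sub[of "L (e r)" "e (Suc r) - L (e r)"] by simp
          also have "\<dots> \<le> \<theta> * \<nu> (e r) + C * (\<eta> * norm (e r))"
            using upper[of "e (Suc r) - L (e r)"] est C
            by (intro add_mono contr) (meson mult_left_mono order_trans le_less_trans not_less zero_le_one)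
          also have "\<dots> \<le> \<theta> * \<nu> (e r) + C * (\<eta> * \<nu> (e r))"
            using lower C \<eta> by (intro add_left_mono mult_left_mono) auto
          also have "\<dots> = \<theta>' * \<nu> (e r)"
            using C by (simp add: \<theta>'_def \<eta>_def field_simps)
          also have "\<dots> \<le> \<theta>' * (\<theta>' ^ r * \<nu> (e 0))"
            using Suc \<theta>' by (intro mult_left_mono) auto
          finally show ?case using I by simp
        qed
        have "norm (e r) < d" for r
        proof -
          have "\<theta>' ^ r * \<nu> (e 0) \<le> 1 * \<nu> (e 0)"
            using \<theta>' pos by (intro mult_right_mono power_le_one) auto
          with inv[of r] lower[of "e r"] \<nu>0 show ?thesis by simp
        qed
        with inv have stay: "\<forall>r. I r \<and> norm (e r) < d" by blast
        have "(\<lambda>r. \<theta>' ^ r * \<nu> (e 0)) \<longlonglongrightarrow> 0 * \<nu> (e 0)"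
          using \<theta>' by (intro tendsto_mult tendsto_const LIMSEQ_power_zero) simp
        then have lim: "(\<lambda>r. \<theta>' ^ r * \<nu> (e 0)) \<longlonglongrightarrow> 0" by simp
        have "norm (e r) \<le> \<theta>' ^ r * \<nu> (e 0)" for r
          using inv[of r] lower[of "e r"] by simp
        then have "e \<longlonglongrightarrow> 0"
          by (intro Lim_null_comparison[OF _ lim] always_eventually) blast
        with stay show "(\<forall>r. I r \<and> norm (e r) < d) \<and> e \<longlonglongrightarrow> 0" by blast
      qed
    qed
  qed
qed

section \<open>Orthogonal projections\<close>

lemma orth_projection_unique:
  assumes V: "subspace V" and p: "p \<in> V" "\<And>v. v \<in> V \<Longrightarrow> orthogonal (y - p) v"
  shows "orth_projection V y = p"
  unfolding orth_projection_def
proof (rule the_equality)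
  fix p' assume p': "p' \<in> V \<and> (\<forall>v\<in>V. orthogonal (y - p') v)"
  have "p' - p \<in> V" using V p' p by (simp add: subspace_diff)
  then have "(y - p) \<bullet> (p' - p) = 0" "(y - p') \<bullet> (p' - p) = 0"
    using p p' by (auto simp: orthogonal_def)
  then have "(p' - p) \<bullet> (p' - p) = 0" by (simp add: inner_diff_left)
  then show "p' = p" by simp
qed (use p in blast)

lemma orth_projection:
  assumes V: "subspace V"
  shows "orth_projection V y \<in> V" and "v \<in> V \<Longrightarrow> orthogonal (y - orth_projection V y) v"
proof -
  have sp: "span V = V" using V by (simp add: span_eq_iff)
  obtain p z where p: "p \<in> V" "\<And>w. w \<in> V \<Longrightarrow> orthogonal z w" "y = p + z"
    using orthogonal_subspace_decomp_exists[of V y] unfolding sp by metis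
  then have "orth_projection V y = p" by (intro orth_projection_unique[OF V]) auto
  with p show "orth_projection V y \<in> V" "v \<in> V \<Longrightarrow> orthogonal (y - orth_projection V y) v" by auto
qed

lemma orth_projection_id: "subspace V \<Longrightarrow> v \<in> V \<Longrightarrow> orth_projection V v = v"
  by (rule orth_projection_unique) (auto simp: orthogonal_def)

lemma linear_orth_projection:
  assumes V: "subspace V"
  shows "linear (orth_projection V)"
proof (rule linearI)
  note P = orth_projection[OF V]
  show "orth_projection V (x + y) = orth_projection V x + orth_projection V y" for x y
  proof (rule orth_projection_unique[OF V])
    show "orth_projection V x + orth_projection V y \<in> V" using P V by (simp add: subspace_add)
    fix v assume "v \<in> V"
    then show "orthogonal (x + y - (orth_projection V x + orth_projection V y)) v"
      using P(2)[of v x] P(2)[of v y] by (simp add: orthogonal_def inner_simps)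
  qed
  show "orth_projection V (c *\<^sub>R x) = c *\<^sub>R orth_projection V x" for c x
  proof (rule orth_projection_unique[OF V])
    show "c *\<^sub>R orth_projection V x \<in> V" using P V by (simp add: subspace_scale)
    fix v assume "v \<in> V"
    then show "orthogonal (c *\<^sub>R x - c *\<^sub>R orth_projection V x) v"
      using P(2)[of v x] by (simp add: orthogonal_def inner_simps)
  qed
qed

lemma norm_orth_projection_le:
  assumes V: "subspace V"
  shows "norm (orth_projection V y) \<le> norm y" and "norm (y - orth_projection V y) \<le> norm y"
proof -
  let ?p = "orth_projection V y"
  have "orthogonal ?p (y - ?p)"
    using orth_projection[OF V] by (simp add: orthogonal_commute)
  then have "(norm (?p + (y - ?p)))\<^sup>2 = (norm ?p)\<^sup>2 + (norm (y - ?p))\<^sup>2"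
    by (rule norm_add_Pythagorean)
  then have "(norm y)\<^sup>2 = (norm ?p)\<^sup>2 + (norm (y - ?p))\<^sup>2" by simp
  then have "(norm ?p)\<^sup>2 \<le> (norm y)\<^sup>2" "(norm (y - ?p))\<^sup>2 \<le> (norm y)\<^sup>2" by auto
  then show "norm ?p \<le> norm y" "norm (y - ?p) \<le> norm y"
    by (auto intro: power2_le_imp_le)
qed

section \<open>The spectrum off a maximal invariant subspace\<close>

abbreviation Re_vec :: "complex^'n \<Rightarrow> real^'n" where "Re_vec w \<equiv> (\<chi> i. Re (w $ i))"
abbreviation Im_vec :: "complex^'n \<Rightarrow> real^'n" where "Im_vec w \<equiv> (\<chi> i. Im (w $ i))"

lemma Re_vec_complexify: "Re_vec (complexify A *v w) = A *v Re_vec w"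
  and Im_vec_complexify: "Im_vec (complexify A *v w) = A *v Im_vec w"
  by (simp_all add: vec_eq_iff matrix_vector_mult_def map_matrix_def)

lemma Re_vec_scale: "Re_vec (c *s w) = Re c *\<^sub>R Re_vec w - Im c *\<^sub>R Im_vec w"
  and Im_vec_scale: "Im_vec (c *s w) = Im c *\<^sub>R Re_vec w + Re c *\<^sub>R Im_vec w"
  by (simp_all add: vec_eq_iff)

lemma complex_vec_eq_0_iff: "w = 0 \<longleftrightarrow> Re_vec w = 0 \<and> Im_vec w = 0"
  by (auto simp: vec_eq_iff complex_eq_iff)

lemma spectrum_enum_eigenvalue:
  fixes A :: "real^'n^'n"
  assumes spec: "spectrum_enum A \<mu>" and w: "w \<noteq> 0" "complexify A *v w = d *s w"
  shows "\<exists>i\<in>{1..CARD('n)}. \<mu> i = d"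
proof -
  have "mat d *v w = d *s w"
    by (auto simp: vec_eq_iff matrix_vector_mult_def mat_def if_distrib[of "\<lambda>x. x * _"]
        cong: if_cong)
  then have "(mat d - complexify A) *v w = 0"
    using w(2) by (simp add: matrix_vector_mult_diff_rdistrib)
  then have "\<not> invertible (mat d - complexify A)"
    using w(1) unfolding invertible_left_inverse matrix_left_invertible_ker by blast
  then have "det (mat d - complexify A) = 0" by (simp add: invertible_det_nz)
  then have "(\<Prod>i\<in>{1..CARD('n)}. d - \<mu> i) = 0"
    using spec unfolding spectrum_enum_def by metis
  then show ?thesis by (auto simp: prod_zero_iff)
qed

text \<open>
  In complex terms: if \<open>w = a + \<i> b\<close> is an eigenvector of \<open>J\<close> modulo \<open>V\<close> for
  \<open>c = \<alpha> + \<i> \<beta>\<close>, then \<open>c\<close> is not one of the outer eigenvalues. Otherwise \<open>V\<close> could be enlarged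
  by \<open>a\<close> and \<open>b\<close>: a new eigenvalue \<open>d\<close> of \<open>J\<close> on the larger space would be \<open>c\<close> or its
  conjugate, because \<open>(J - c) (J - cnj c)\<close> maps the larger space into \<open>V\<close>; as a root of the
  characteristic polynomial of modulus \<open>\<bar>c\<bar>\<close> it would be an outer \<open>\<mu> i\<close>, against maximality.
\<close>

lemma maximal_invariant_quotient:
  fixes J :: "real^'n^'n" and a b :: "real^'n"
  assumes spec: "spectrum_enum J \<mu>"
    and inner: "\<And>i. i \<in> {M+1..CARD('n)} \<Longrightarrow> cmod (\<mu> i) < R" 
    and V: "maximal_invariant_subspace J (\<mu> ` {1..M}) V"
    and a: "J *v a - (\<alpha> *\<^sub>R a - \<beta> *\<^sub>R b) \<in> V" and b: "J *v b - (\<beta> *\<^sub>R a + \<alpha> *\<^sub>R b) \<in> V"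
    and notin: "\<not> (a \<in> V \<and> b \<in> V)"
  shows "cmod (Complex \<alpha> \<beta>) < R"
proof (rule ccontr)
  assume large: "\<not> cmod (Complex \<alpha> \<beta>) < R"
  have sub: "subspace V" and inv: "\<And>v. v \<in> V \<Longrightarrow> J *v v \<in> V"
    and ev: "\<And>c. eigenvalue_on J V c \<Longrightarrow> c \<in> \<mu> ` {1..M}"
    and max: "\<And>W. invariant_subspace_for J (\<mu> ` {1..M}) W \<Longrightarrow> V \<subseteq> W \<Longrightarrow> W = V"
    using V by (auto simp: maximal_invariant_subspace_def invariant_subspace_for_def)
  note cl = subspace_add[OF sub] subspace_diff[OF sub] subspace_scale[OF sub]
  define W where "W = span (V \<union> {a, b})"
  have subW: "subspace W" by (simp add: W_def)
  have VW: "V \<subseteq> W" and aW: "a \<in> W" and bW: "b \<in> W"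
    unfolding W_def by (auto intro: span_base)
  define v1 v2 where "v1 = J *v a - (\<alpha> *\<^sub>R a - \<beta> *\<^sub>R b)"
    and "v2 = J *v b - (\<beta> *\<^sub>R a + \<alpha> *\<^sub>R b)"
  then have v: "v1 \<in> V" "v2 \<in> V"
    and Ja: "J *v a = \<alpha> *\<^sub>R a - \<beta> *\<^sub>R b + v1" and Jb: "J *v b = \<beta> *\<^sub>R a + \<alpha> *\<^sub>R b + v2"
    using a b by auto
  note Jsimps = matrix_vector_right_distrib matrix_vector_mult_diff_distrib
    matrix_vector_mult_scaleR
  have JW: "J *v x \<in> W" if "x \<in> W" for x
  proof -
    have "subspace {x. J *v x \<in> W}"
      using subW by (auto simp: subspace_def Jsimps)
    moreover have "V \<union> {a, b} \<subseteq> {x. J *v x \<in> W}"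
      using inv VW v subW aW bW
      by (auto simp: Ja Jb subset_iff intro!: subspace_add subspace_diff subspace_scale)
    ultimately show ?thesis using that span_minimal unfolding W_def by blast
  qed
  \<comment> \<open>The real quadratic \<open>(J - c) (J - cnj c)\<close> with \<open>c = \<alpha> + \<i> \<beta>\<close>; it annihilates \<open>W\<close> modulo \<open>V\<close>.\<close>
  define N where "N x = J *v (J *v x) - (2 * \<alpha>) *\<^sub>R (J *v x) + (\<alpha>\<^sup>2 + \<beta>\<^sup>2) *\<^sub>R x" for x
  have NV: "N x \<in> V" if "x \<in> W" for x
  proof -
    have N_lin: "N (x + y) = N x + N y" "N (c *\<^sub>R x) = c *\<^sub>R N x" for x y c
      by (simp_all add: N_def Jsimps algebra_simps)
    have "N 0 = 0" by (simp add: N_def)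
    then have "subspace {x. N x \<in> V}"
      using sub by (auto simp: subspace_def N_lin)
    moreover have "N a \<in> V"
    proof -
      have "N a = J *v v1 - \<alpha> *\<^sub>R v1 - \<beta> *\<^sub>R v2"
        unfolding N_def Ja Jb Jsimps by (simp add: vec_eq_iff algebra_simps power2_eq_square)
      then show ?thesis using v inv cl by simp
    qed
    moreover have "N b \<in> V"
    proof -
      have "N b = J *v v2 - \<alpha> *\<^sub>R v2 + \<beta> *\<^sub>R v1"
        unfolding N_def Ja Jb Jsimps by (simp add: vec_eq_iff algebra_simps power2_eq_square)
      then show ?thesis using v inv cl by simp
    qed
    moreover have "N x \<in> V" if "x \<in> V" for x
      unfolding N_def using that inv cl by simp
    ultimately have "W \<subseteq> {x. N x \<in> V}"
      unfolding W_def by (intro span_minimal) auto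
    then show ?thesis using that by blast
  qed
  have "d \<in> \<mu> ` {1..M}" if "eigenvalue_on J W d" for d
  proof -
    from that obtain u where u: "u \<noteq> 0" "Re_vec u \<in> W" "Im_vec u \<in> W"
      "complexify J *v u = d *s u" unfolding eigenvalue_on_def by blast
    show ?thesis
    proof (cases "Re_vec u \<in> V \<and> Im_vec u \<in> V")
      case True
      then have "eigenvalue_on J V d" using u unfolding eigenvalue_on_def by blast
      then show ?thesis by (rule ev)
    next
      case False
      define \<kappa> where "\<kappa> = (d - Complex \<alpha> \<beta>) * (d - cnj (Complex \<alpha> \<beta>))"
      have \<kappa>: "\<kappa> = d * d - complex_of_real (2 * \<alpha>) * d + complex_of_real (\<alpha>\<^sup>2 + \<beta>\<^sup>2)"
        by (simp add: \<kappa>_def complex_eq_iff algebra_simps power2_eq_square)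
      have NC: "\<kappa> *s u = complexify J *v (complexify J *v u)
          - complex_of_real (2 * \<alpha>) *s (complexify J *v u) + complex_of_real (\<alpha>\<^sup>2 + \<beta>\<^sup>2) *s u"
        unfolding u(4) \<kappa> vec.scale
        by (simp only: vec_eq_iff vector_add_component vector_minus_component
            vector_smult_component) (simp add: algebra_simps)
      have "Re_vec (\<kappa> *s u) = N (Re_vec u)"
      proof -
        have "Re_vec (\<kappa> *s u) = Re_vec (complexify J *v (complexify J *v u))
          - (2 * \<alpha>) *\<^sub>R Re_vec (complexify J *v u) + (\<alpha>\<^sup>2 + \<beta>\<^sup>2) *\<^sub>R Re_vec u"
          unfolding NC by (simp add: vec_eq_iff algebra_simps)
        then show ?thesis by (simp only: Re_vec_complexify N_def)
      qed
      moreover have "Im_vec (\<kappa> *s u) = N (Im_vec u)"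
      proof -
        have "Im_vec (\<kappa> *s u) = Im_vec (complexify J *v (complexify J *v u))
          - (2 * \<alpha>) *\<^sub>R Im_vec (complexify J *v u) + (\<alpha>\<^sup>2 + \<beta>\<^sup>2) *\<^sub>R Im_vec u"
          unfolding NC by (simp add: vec_eq_iff algebra_simps)
        then show ?thesis by (simp only: Im_vec_complexify N_def)
      qed
      ultimately have inV: "Re_vec (\<kappa> *s u) \<in> V" "Im_vec (\<kappa> *s u) \<in> V"
        using NV u by auto
      have "\<kappa> = 0"
      proof (rule ccontr)
        assume "\<kappa> \<noteq> 0"
        then have "u = inverse \<kappa> *s (\<kappa> *s u)" by (simp add: vec_eq_iff)
        then have "Re_vec u = Re_vec (inverse \<kappa> *s (\<kappa> *s u))"
          "Im_vec u = Im_vec (inverse \<kappa> *s (\<kappa> *s u))" by simp_all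
        then have "Re_vec u \<in> V" "Im_vec u \<in> V"
          unfolding Re_vec_scale[of "inverse \<kappa>" "\<kappa> *s u"] Im_vec_scale[of "inverse \<kappa>" "\<kappa> *s u"]
          using inV cl by metis+
        with False show False by blast
      qed
      then have "d = Complex \<alpha> \<beta> \<or> d = cnj (Complex \<alpha> \<beta>)" by (simp add: \<kappa>_def)
      then have "cmod d = cmod (Complex \<alpha> \<beta>)" by (metis complex_mod_cnj)
      moreover from spectrum_enum_eigenvalue[OF spec u(1,4)]
      obtain i where i: "i \<in> {1..CARD('n)}" "\<mu> i = d" by blast
      ultimately have "i \<notin> {M+1..CARD('n)}" using inner large by metis
      with i have "i \<in> {1..M}" by auto
      with i show ?thesis by blast
    qed
  qed
  then have "invariant_subspace_for J (\<mu> ` {1..M}) W"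
    using subW JW by (auto simp: invariant_subspace_for_def)
  then have "W = V" using max VW by blast
  with aW bW notin show False by blast
qed

text \<open>
  An eigenvector of \<open>Q J Q\<close> for a nonzero eigenvalue lies in the complement of \<open>V\<close> and is an eigenvector
  of \<open>J\<close> modulo \<open>V\<close>, so \<open>Q J Q\<close> has only inner eigenvalues.
\<close>

lemma compression_powers_tendsto_zero:
  fixes J :: "real^'n^'n"
  assumes spec: "spectrum_enum J \<mu>"
    and inner: "\<And>i. i \<in> {M+1..CARD('n)} \<Longrightarrow> cmod (\<mu> i) < R" and R: "R \<le> 1"
    and V: "maximal_invariant_subspace J (\<mu> ` {1..M}) V"
  defines "Q \<equiv> \<lambda>x. x - orth_projection V x"
  shows "(\<lambda>k. ((\<lambda>x. Q (J *v Q x)) ^^ k) x) \<longlonglongrightarrow> 0"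
proof -
  have sub: "subspace V" using V
    by (auto simp: maximal_invariant_subspace_def invariant_subspace_for_def)
  note P = orth_projection[OF sub]
  have linP: "linear (orth_projection V)" by (rule linear_orth_projection[OF sub])
  define T where "T x = Q (J *v Q x)" for x
  have linQ: "linear Q" unfolding Q_def by (intro linear_compose_sub linear_id[unfolded id_def] linP)
  have linT: "linear T" unfolding T_def
    using linear_compose[OF linear_compose[OF linQ matrix_vector_mul_linear] linQ, of J]
    by (simp add: o_def)
  define B where "B = matrix T"
  have B: "B *v x = T x" for x unfolding B_def by (rule fun_cong[OF matrix_vector_mul(2)[OF linT]])
  have Q_orth: "Q x \<bullet> v = 0" if "v \<in> V" for x v
    using P(2)[OF that] by (simp add: Q_def orthogonal_def)
  have Q_id: "Q x = x" if "\<And>v. v \<in> V \<Longrightarrow> x \<bullet> v = 0" for x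
  proof -
    have "orth_projection V x = 0"
      using that by (intro orth_projection_unique[OF sub] subspace_0[OF sub])
        (auto simp: orthogonal_def)
    then show ?thesis by (simp add: Q_def)
  qed
  have "cmod c < 1" if w: "w \<noteq> 0" "complexify B *v w = c *s w" for c w
  proof (cases "c = 0")
    case False
    define a b where "a = Re_vec w" and "b = Im_vec w"
    define \<alpha> \<beta> where "\<alpha> = Re c" and "\<beta> = Im c"
    have Ta: "T a = \<alpha> *\<^sub>R a - \<beta> *\<^sub>R b"
      using arg_cong[OF w(2), of Re_vec]
      unfolding Re_vec_complexify Re_vec_scale B a_def b_def \<alpha>_def \<beta>_def .
    have Tb: "T b = \<beta> *\<^sub>R a + \<alpha> *\<^sub>R b"
      using arg_cong[OF w(2), of Im_vec]
      unfolding Im_vec_complexify Im_vec_scale B a_def b_def \<alpha>_def \<beta>_def .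
    have nz: "\<alpha>\<^sup>2 + \<beta>\<^sup>2 \<noteq> 0"
      using False by (simp add: \<alpha>_def \<beta>_def complex_eq_iff sum_power2_eq_zero_iff)
    have orth: "a \<bullet> v = 0" "b \<bullet> v = 0" if v: "v \<in> V" for v
    proof -
      have 1: "\<alpha> * (a \<bullet> v) - \<beta> * (b \<bullet> v) = 0"
        using Q_orth[OF v, of "J *v Q a"] Ta by (simp add: T_def inner_simps)
      have 2: "\<beta> * (a \<bullet> v) + \<alpha> * (b \<bullet> v) = 0"
        using Q_orth[OF v, of "J *v Q b"] Tb by (simp add: T_def inner_simps)
      have "(\<alpha>\<^sup>2 + \<beta>\<^sup>2) * (a \<bullet> v) = \<alpha> * (\<alpha> * (a \<bullet> v) - \<beta> * (b \<bullet> v)) + \<beta> * (\<beta> * (a \<bullet> v) + \<alpha> * (b \<bullet> v))"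
        "(\<alpha>\<^sup>2 + \<beta>\<^sup>2) * (b \<bullet> v) = \<alpha> * (\<beta> * (a \<bullet> v) + \<alpha> * (b \<bullet> v)) - \<beta> * (\<alpha> * (a \<bullet> v) - \<beta> * (b \<bullet> v))"
        by (simp_all add: algebra_simps power2_eq_square)
      then show "a \<bullet> v = 0" "b \<bullet> v = 0" unfolding 1 2 using nz by auto
    qed
    have Qa: "Q a = a" and Qb: "Q b = b" using orth by (auto intro: Q_id)
    have "J *v a - (\<alpha> *\<^sub>R a - \<beta> *\<^sub>R b) = orth_projection V (J *v a)"
      unfolding Ta[symmetric] T_def Qa by (simp add: Q_def)
    moreover have "J *v b - (\<beta> *\<^sub>R a + \<alpha> *\<^sub>R b) = orth_projection V (J *v b)"
      unfolding Tb[symmetric] T_def Qb by (simp add: Q_def)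
    moreover have "\<not> (a \<in> V \<and> b \<in> V)"
    proof
      assume "a \<in> V \<and> b \<in> V"
      then have "a = 0" "b = 0" using orth[of a] orth[of b] by auto
      with w(1) show False unfolding a_def b_def complex_vec_eq_0_iff[of w] by blast
    qed
    ultimately have "cmod (Complex \<alpha> \<beta>) < R"
      using P by (intro maximal_invariant_quotient[OF spec inner V]) auto
    then show ?thesis using R by (simp add: \<alpha>_def \<beta>_def)
  qed simp
  then have lim: "(\<lambda>k. ((*v) (complexify B) ^^ k) u) \<longlonglongrightarrow> 0" for u
    by (rule spectral_radius_powers_tendsto_zero)
  define u where "u = (\<chi> i. complex_of_real (x $ i))"
  have re: "Re_vec (((*v) (complexify B) ^^ k) u) = (T ^^ k) x" for k
  proof (induction k)
    case 0
    then show ?case by (simp add: u_def)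
  next
    case (Suc k)
    then show ?case by (simp only: funpow.simps o_apply Re_vec_complexify B)
  qed
  have "(\<lambda>k. (T ^^ k) x) \<longlonglongrightarrow> 0"
  proof (rule vec_tendstoI)
    fix i
    have "(\<lambda>k. Re (((*v) (complexify B) ^^ k) u $ i)) \<longlonglongrightarrow> Re (0 $ i)"
      by (intro tendsto_Re tendsto_vec_nth lim)
    moreover have "Re (((*v) (complexify B) ^^ k) u $ i) = (T ^^ k) x $ i" for k
      using arg_cong[OF re[of k], of "\<lambda>v. v $ i"] by simp
    ultimately show "(\<lambda>k. (T ^^ k) x $ i) \<longlonglongrightarrow> 0 $ i" by simp
  qed
  then show ?thesis unfolding T_def[abs_def] .
qed

section \<open>Local convergence of the Newton--Picard scheme\<close>

text \<open>
  The Newton operator, taken on the whole space, is the identity on the complement of \<open>V\<close>, so a lower bound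
  may be required on the whole space instead of on \<open>V\<close>.
\<close>

lemma newton_op_restrict_bij:
  assumes V: "subspace V" and c: "c > 0" "\<And>v. c * norm v \<le> norm (newton_op F V y v)"
  shows "bij_betw (newton_op F V y) V V"
proof -
  note P = orth_projection[OF V]
  have lin: "linear (newton_op F V y)"
    unfolding newton_op_def[abs_def]
    using linear_compose[OF linear_compose[OF linear_orth_projection[OF V] matrix_vector_mul_linear]
        linear_orth_projection[OF V], of "jacobian F (at y)"]
    by (intro linear_compose_sub linear_id[unfolded id_def]) (simp add: o_def)
  have inj: "inj (newton_op F V y)"
    unfolding linear_injective_0[OF lin] using c(2) c(1)
    by (metis mult_le_0_iff norm_le_zero_iff norm_zero not_le)
  have into: "newton_op F V y ` V \<subseteq> V"
    using P V by (auto simp: newton_op_def subspace_diff)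
  have "dim (newton_op F V y ` V) = dim V"
    using dim_image_eq[OF lin] inj by (metis inj_on_subset subset_UNIV)
  then have "newton_op F V y ` V = V"
    using subspace_dim_equal[OF linear_subspace_image[OF lin V] V into] by simp
  then show ?thesis using inj by (auto simp: bij_betw_def intro: inj_on_subset)
qed

text \<open>
  The hypothesis \<open>regular\<close> says that 1 is not an eigenvalue of the Jacobian, which makes the Newton operator
  invertible at the fixed point and, by continuity of the Jacobian, uniformly near it. With
  \<open>e = y - z\<close> one step then sends \<open>P e\<close> to \<open>(I - P J P)\<^bsup>-1\<^esup> P J Q e\<close> and \<open>Q e\<close> to \<open>Q J Q e\<close>, up
  to \<open>o(norm e)\<close>; invariance of \<open>V\<close> kills the term \<open>Q J P e\<close>. The triangular form of this linear map
  reduces everything to the decay of the powers of \<open>Q J Q\<close>.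
\<close>

lemma newton_picard_converges:
  fixes F :: "real^'n \<Rightarrow> real^'n" and z :: "real^'n"
  defines "J \<equiv> jacobian F (at z)"
  assumes V: "subspace V" and inv: "\<And>v. v \<in> V \<Longrightarrow> J *v v \<in> V"
    and fixpt: "F z = z" and diff: "F differentiable (at z)"
    and cont: "\<And>b. ((\<lambda>y. jacobian F (at y) *v b) \<longlongrightarrow> J *v b) (nhds z)"
    and regular: "\<And>v. J *v v = v \<Longrightarrow> v = 0"
    and pow: "\<And>x. (\<lambda>k. ((\<lambda>x. (J *v (x - orth_projection V x))
        - orth_projection V (J *v (x - orth_projection V x))) ^^ k) x) \<longlonglongrightarrow> 0"
  shows "\<exists>\<rho>>0. \<forall>y\<^sub>1\<in>ball z \<rho>. \<forall>p q. newton_picard_iteration F V y\<^sub>1 p q \<longrightarrow>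
    (\<forall>r\<ge>1. bij_betw (newton_op F V (p r + q r)) V V) \<and> (\<lambda>r. p r + q r) \<longlonglongrightarrow> z"
proof -
  define P where "P = orth_projection V"
  define Q where "Q x = x - P x" for x
  define T where "T x = Q (J *v Q x)" for x
  note PV = orth_projection(1)[OF V, folded P_def]
  have linP: "linear P" unfolding P_def by (rule linear_orth_projection[OF V])
  have linQ: "linear Q" unfolding Q_def by (intro linear_compose_sub linear_id[unfolded id_def] linP)
  note P_add = linear_add[OF linP] and P_diff = linear_diff[OF linP]
    and Q_add = linear_add[OF linQ]
  have P_le: "norm (P x) \<le> norm x" and Q_le: "norm (Q x) \<le> norm x" for x
    unfolding Q_def P_def by (rule norm_orth_projection_le[OF V])+
  have P_id: "P v = v" if "v \<in> V" for v
    unfolding P_def by (rule orth_projection_id[OF V that])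
  have PP: "P (P x) = P x" for x by (rule P_id[OF PV])
  have PQ: "P (Q x) = 0" for x by (simp add: Q_def P_diff PP)
  have QQ: "Q (Q x) = Q x" for x by (simp add: Q_def P_diff PP)
  have QV: "Q v = 0" if "v \<in> V" for v using P_id[OF that] by (simp add: Q_def)
  have QJP: "Q (J *v P x) = 0" for x by (rule QV[OF inv[OF PV]])
  have QJ: "Q (J *v x) = Q (J *v Q x)" for x
  proof -
    have "J *v x = J *v P x + J *v Q x"
      unfolding matrix_vector_right_distrib[symmetric] by (simp add: Q_def)
    then show ?thesis by (simp add: Q_add QJP)
  qed

  define N where "N = newton_op F V"
  have N_eq: "N y v = v - P (jacobian F (at y) *v P v)" for y v
    by (simp add: N_def newton_op_def P_def)
  define N0 where "N0 = N z"
  have N0_eq: "N0 v = v - P (J *v P v)" for v by (simp add: N0_def N_eq J_def)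
  have linN: "linear (N y)" for y
    unfolding N_eq[abs_def]
    using linear_compose[OF linear_compose[OF linP matrix_vector_mul_linear] linP,
        of "jacobian F (at y)"]
    by (intro linear_compose_sub linear_id[unfolded id_def]) (simp add: o_def)
  have linN0: "linear N0" unfolding N0_def by (rule linN)
  have injN0: "inj N0"
    unfolding linear_injective_0[OF linN0]
  proof (intro allI impI)
    fix v assume "N0 v = 0"
    then have v: "v = P (J *v P v)" by (simp add: N0_eq)
    then have "v \<in> V" using PV by metis
    then have "J *v v = v" using v P_id[OF \<open>v \<in> V\<close>] P_id[OF inv[OF \<open>v \<in> V\<close>]] by simp
    then show "v = 0" by (rule regular)
  qed
  obtain c where c: "c > 0" and c_le: "\<And>v. c * norm v \<le> norm (N0 v)"
    using linear_inj_bounded_below_pos[OF linN0 injN0] by metis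
  obtain G where linG: "linear G" and GN: "\<And>x. G (N0 x) = x" and NG: "\<And>x. N0 (G x) = x"
    using linear_injective_isomorphism[OF linN0 injN0] by metis
  have GV: "G v \<in> V" if "v \<in> V" for v
  proof -
    have "G v = v + P (J *v P (G v))" using NG[of v] by (simp add: N0_eq algebra_simps)
    also have "\<dots> \<in> V" using that PV V by (simp add: subspace_add)
    finally show ?thesis .
  qed

  \<comment> \<open>In error coordinates a step is \<open>L e\<close> up to \<open>o(norm e)\<close>. Newton cancels the \<open>P\<close>-part of
    \<open>e\<close>, so \<open>L\<close> reads only \<open>Q e\<close>, and \<open>Q L = T Q\<close>; hence the powers of \<open>L\<close> inherit the decay of
    those of \<open>T\<close>.\<close>
  define L where "L e = G (P (J *v Q e)) + Q (J *v e)" for e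
  have linL: "linear L"
    unfolding L_def
    using linear_compose[OF linear_compose[OF linear_compose[OF linQ matrix_vector_mul_linear] linP] linG, of J]
      linear_compose[OF matrix_vector_mul_linear linQ, of J]
    by (intro linear_compose_add) (simp_all add: o_def)
  have QL: "Q (L e) = T e" for e
    unfolding L_def T_def Q_add QQ QV[OF GV[OF PV]] by (simp add: QJ[symmetric])
  have LQ: "L (Q e) = L e" for e
    unfolding L_def QQ by (simp add: QJ[symmetric])
  have TQ: "T (Q e) = T e" for e by (simp add: T_def QQ)
  have Lpow: "Q ((L ^^ k) x) = (T ^^ k) (Q x)" for k x
    by (induction k) (simp_all add: QL, metis TQ)
  have powT: "(\<lambda>k. (T ^^ k) x) \<longlonglongrightarrow> 0" for x
    using pow[of x] unfolding T_def[abs_def] Q_def P_def .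
  have powL: "(\<lambda>k. (L ^^ k) x) \<longlonglongrightarrow> 0" for x
  proof -
    have bl: "bounded_linear L" using linL by (simp add: linear_conv_bounded_linear)
    have "(\<lambda>k. L ((T ^^ k) (Q x))) \<longlonglongrightarrow> L 0"
      by (rule bounded_linear.tendsto[OF bl powT])
    moreover have "L ((T ^^ k) (Q x)) = (L ^^ Suc k) x" for k
      by (simp add: Lpow[symmetric] LQ)
    ultimately have "(\<lambda>k. (L ^^ Suc k) x) \<longlonglongrightarrow> 0" by (simp only: linear_0[OF linL])
    then show ?thesis by (rule LIMSEQ_imp_Suc)
  qed
  obtain \<eta> where \<eta>: "\<eta> > 0" and stab: "\<And>d. d > 0 \<Longrightarrow> \<exists>\<rho>>0. \<forall>(e::nat \<Rightarrow> real^'n) I.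
    norm (e 0) < \<rho> \<and> I 0 \<and>
    (\<forall>r. I r \<and> norm (e r) < d \<longrightarrow> I (Suc r) \<and> norm (e (Suc r) - L (e r)) \<le> \<eta> * norm (e r)) \<longrightarrow>
    (\<forall>r. I r \<and> norm (e r) < d) \<and> e \<longlonglongrightarrow> 0"
    using local_stability[OF linL powL] by blast

  define j where "j = (\<Sum>b\<in>Basis. norm (J *v b))"
  have j: "norm (J *v x) \<le> norm x * j" for x
    unfolding j_def by (rule linear_norm_le_sum_Basis[OF matrix_vector_mul_linear])
  have j0: "j \<ge> 0" unfolding j_def by (intro sum_nonneg) auto
  \<comment> \<open>\<open>S\<close> bounds the Newton correction \<open>s\<close> by \<open>norm s \<le> S * norm e\<close>; \<open>\<kappa>\<close> is the accuracy
    demanded of the linearization of \<open>F\<close> and of its Jacobian so that the step defect is at most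
    \<open>\<eta> * norm e\<close> and the Newton operator stays bounded below by \<open>c / 2\<close>.\<close>
  define S where "S = (2 / c) * (c / 2 + j + 1)"
  have S0: "S \<ge> 0" using c j0 by (simp add: S_def)
  define \<kappa> where "\<kappa> = min (c / 2) (\<eta> / ((1 + S) / c + 1))"
  have den: "(1 + S) / c + 1 > 0" using c S0 by (intro add_nonneg_pos) auto
  have \<kappa>: "\<kappa> > 0" "\<kappa> \<le> c / 2" and \<kappa>\<eta>: "\<kappa> * ((1 + S) / c + 1) \<le> \<eta>"
  proof -
    show "\<kappa> > 0" using c \<eta> den by (simp add: \<kappa>_def)
    show "\<kappa> \<le> c / 2" unfolding \<kappa>_def by (rule min.cobounded1)
    have "\<kappa> \<le> \<eta> / ((1 + S) / c + 1)" by (simp add: \<kappa>_def)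
    then show "\<kappa> * ((1 + S) / c + 1) \<le> \<eta>" using den by (simp only: pos_le_divide_eq)
  qed
  have "(F has_derivative (\<lambda>h. J *v h)) (at z)"
    using diff unfolding J_def by (simp only: jacobian_works)
  then obtain d1 where d1: "d1 > 0"
    and F_lin: "\<And>y. norm (y - z) < d1 \<Longrightarrow> norm (F y - F z - J *v (y - z)) \<le> \<kappa> * norm (y - z)"
    using \<kappa>(1) unfolding has_derivative_at_alt by blast
  have "((\<lambda>y. \<Sum>b\<in>Basis. norm ((jacobian F (at y) - J) *v b)) \<longlongrightarrow>
      (\<Sum>b\<in>(Basis::(real^'n) set). norm (J *v b - J *v b))) (nhds z)"
    unfolding matrix_vector_mult_diff_rdistrib
    by (intro tendsto_sum tendsto_norm tendsto_diff tendsto_const cont)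
  then have "((\<lambda>y. \<Sum>b\<in>(Basis::(real^'n) set). norm ((jacobian F (at y) - J) *v b)) \<longlongrightarrow> 0) (nhds z)"
    by simp
  then have "\<forall>\<^sub>F y in nhds z. (\<Sum>b\<in>(Basis::(real^'n) set). norm ((jacobian F (at y) - J) *v b)) < \<kappa>"
    using \<kappa>(1) by (rule order_tendstoD(2))
  then obtain d2 where d2: "d2 > 0" and J_close: "\<And>y. dist y z < d2 \<Longrightarrow>
      (\<Sum>b\<in>(Basis::(real^'n) set). norm ((jacobian F (at y) - J) *v b)) < \<kappa>"
    unfolding eventually_nhds_metric by blast
  define d where "d = min d1 d2"
  have d: "d > 0" using d1 d2 by (simp add: d_def)

  have N_close: "norm (N0 v - N y v) \<le> \<kappa> * norm v" if "norm (y - z) < d" for y v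
  proof -
    have "N0 v - N y v = P ((jacobian F (at y) - J) *v P v)"
      by (simp add: N0_eq N_eq matrix_vector_mult_diff_rdistrib P_diff)
    then have "norm (N0 v - N y v) \<le> norm ((jacobian F (at y) - J) *v P v)"
      using P_le by simp
    also have "\<dots> \<le> norm (P v) * (\<Sum>b\<in>Basis. norm ((jacobian F (at y) - J) *v b))"
      by (rule linear_norm_le_sum_Basis[OF matrix_vector_mul_linear])
    also have "\<dots> \<le> norm v * \<kappa>"
      using P_le J_close[of y] that
      by (intro mult_mono sum_nonneg) (auto simp: d_def dist_norm)
    finally show ?thesis by (simp add: mult.commute)
  qed
  have N_lower: "c / 2 * norm v \<le> norm (N y v)" if "norm (y - z) < d" for y v
  proof -
    have "c * norm v \<le> norm (N y v) + norm (N0 v - N y v)"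
      using c_le[of v] norm_triangle_ineq[of "N y v" "N0 v - N y v"] by simp
    also have "norm (N0 v - N y v) \<le> c / 2 * norm v"
      using N_close[OF that, of v] \<kappa>(2) by (meson mult_right_mono norm_ge_zero order_trans)
    finally show ?thesis by simp
  qed
  have bij: "bij_betw (N y) V V" if "norm (y - z) < d" for y
    unfolding N_def using N_lower[OF that] c
    by (intro newton_op_restrict_bij[OF V, of "c / 2"]) (auto simp: N_def)

  have step: "norm (P y + s + Q (F y) - z - L (y - z)) \<le> \<eta> * norm (y - z)"
    if y: "norm (y - z) < d" and s: "N y s = P (F y) - P y" for y s
  proof -
    define e where "e = y - z"
    define R where "R = F y - z - J *v e"
    have R: "norm R \<le> \<kappa> * norm e"
      using F_lin[of y] y by (simp add: R_def e_def d_def fixpt)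
    have Fy: "F y = z + J *v e + R" by (simp add: R_def)
    have ye: "y = z + e" by (simp add: e_def)
    have Ns: "N y s = P (J *v e) - P e + P R"
      unfolding s unfolding Fy unfolding ye by (simp add: P_add)
    have "c / 2 * norm s \<le> norm (N y s)" by (rule N_lower[OF y])
    also have "\<dots> \<le> norm (P (J *v e)) + norm (P e) + norm (P R)"
      unfolding Ns by (meson norm_triangle_ineq norm_triangle_ineq4 add_right_mono order_trans)
    also have "\<dots> \<le> norm e * j + norm e + \<kappa> * norm e"
      using P_le[of "J *v e"] P_le[of e] P_le[of R] j[of e] R by linarith
    also have "\<dots> \<le> norm e * j + norm e + c / 2 * norm e"
      using \<kappa>(2) by (intro add_left_mono mult_right_mono) auto
    finally have "norm s \<le> S * norm e"
      using c by (simp add: S_def field_simps)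
    \<comment> \<open>\<open>b\<close> is the defect of the \<open>P\<close>-component; applying \<open>N0\<close> to it removes the inverse \<open>G\<close>.\<close>
    define b where "b = P e + s - G (P (J *v Q e))"
    have "N0 b = N0 (P e) + N0 s - P (J *v Q e)"
      unfolding b_def linear_diff[OF linN0] linear_add[OF linN0] NG ..
    also have "N0 (P e) = P e - P (J *v P e)" by (simp add: N0_eq PP)
    also have "N0 s = (N0 s - N y s) + (P (J *v e) - P e + P R)" by (simp add: Ns)
    also have "J *v e = J *v P e + J *v Q e"
      unfolding matrix_vector_right_distrib[symmetric] by (simp add: Q_def)
    finally have "N0 b = (N0 s - N y s) + P R" by (simp add: P_add)
    then have "c * norm b \<le> norm (N0 s - N y s) + norm (P R)"
      using c_le[of b] norm_triangle_ineq[of "N0 s - N y s" "P R"] by simp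
    also have "\<dots> \<le> \<kappa> * norm s + \<kappa> * norm e"
      using N_close[OF y, of s] P_le[of R] R by linarith
    also have "\<dots> \<le> \<kappa> * (S * norm e) + \<kappa> * norm e"
      using \<open>norm s \<le> S * norm e\<close> \<kappa>(1) by (intro add_right_mono mult_left_mono) auto
    finally have b: "norm b \<le> \<kappa> * ((1 + S) / c) * norm e"
      using c by (simp add: field_simps)
    have "P y + s + Q (F y) - z - L (y - z) = b + Q R"
    proof -
      have "z = P z + Q z" by (simp add: Q_def)
      then show ?thesis
        unfolding Fy e_def[symmetric] L_def b_def unfolding ye P_add Q_add
        by (simp add: algebra_simps)
    qed
    then have "norm (P y + s + Q (F y) - z - L (y - z)) \<le> norm b + norm (Q R)"
      by (simp add: norm_triangle_ineq)
    also have "\<dots> \<le> \<kappa> * ((1 + S) / c) * norm e + \<kappa> * norm e"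
      using b Q_le[of R] R by linarith
    also have "\<dots> = (\<kappa> * ((1 + S) / c + 1)) * norm e" by (simp add: algebra_simps)
    also have "\<dots> \<le> \<eta> * norm e" using \<kappa>\<eta> by (intro mult_right_mono) auto
    finally show ?thesis by (simp add: e_def)
  qed

  from stab[OF d] obtain \<rho> where \<rho>: "\<rho> > 0" and stab': "\<And>(e::nat \<Rightarrow> real^'n) I.
    norm (e 0) < \<rho> \<Longrightarrow> I 0 \<Longrightarrow> (\<And>r. I r \<Longrightarrow> norm (e r) < d \<Longrightarrow>
      I (Suc r) \<and> norm (e (Suc r) - L (e r)) \<le> \<eta> * norm (e r)) \<Longrightarrow>
    (\<forall>r. I r \<and> norm (e r) < d) \<and> e \<longlonglongrightarrow> 0" by metis
  show ?thesis
  proof (rule exI[of _ \<rho>], rule conjI[OF \<rho>], intro ballI allI impI)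
    fix y\<^sub>1 p q
    assume y1: "y\<^sub>1 \<in> ball z \<rho>" and it: "newton_picard_iteration F V y\<^sub>1 p q"
    have init: "p 1 = P y\<^sub>1" "q 1 = Q y\<^sub>1"
      and pstep: "\<And>r. r \<ge> 1 \<Longrightarrow> p (r + 1)
        = p r + inv_into V (N (p r + q r)) (P (F (p r + q r)) - p r)"
      and qstep: "\<And>r. r \<ge> 1 \<Longrightarrow> q (r + 1) = Q (F (p r + q r))"
      using it by (auto simp: newton_picard_iteration_def P_def Q_def N_def Let_def)
    define e where "e r = p (Suc r) + q (Suc r) - z" for r
    \<comment> \<open>The components stay in \<open>V\<close> and its complement only as long as the Newton operator was
      invertible so far, so this is carried along with the bound on the error.\<close>
    define I where "I r \<longleftrightarrow> p (Suc r) \<in> V \<and> P (q (Suc r)) = 0" for r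
    have "(\<forall>r. I r \<and> norm (e r) < d) \<and> e \<longlonglongrightarrow> 0"
    proof (rule stab')
      have "e 0 = y\<^sub>1 - z" using init by (simp add: e_def Q_def)
      then show "norm (e 0) < \<rho>" using y1 by (simp add: dist_norm norm_minus_commute)
      show "I 0" using init PV PQ by (simp add: I_def)
    next
      fix r assume I: "I r" and small: "norm (e r) < d"
      define y where "y = p (Suc r) + q (Suc r)"
      have y: "norm (y - z) < d" using small by (simp add: e_def y_def)
      have Py: "P y = p (Suc r)" using I by (simp add: I_def y_def P_add P_id)
      define s where "s = inv_into V (N y) (P (F y) - p (Suc r))"
      have "P (F y) - p (Suc r) \<in> V" using PV I V by (simp add: I_def subspace_diff)
      then have tgt: "P (F y) - p (Suc r) \<in> N y ` V" using bij[OF y] by (simp add: bij_betw_def)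
      have sV: "s \<in> V" unfolding s_def by (rule inv_into_into[OF tgt])
      have Ns: "N y s = P (F y) - P y"
        unfolding s_def Py by (rule f_inv_into_f[OF tgt])
      have next_p: "p (Suc (Suc r)) = P y + s" and next_q: "q (Suc (Suc r)) = Q (F y)"
        using pstep[of "Suc r"] qstep[of "Suc r"] by (simp_all add: s_def y_def[symmetric] Py)
      have "I (Suc r)" unfolding I_def next_p next_q using PV sV V PQ by (simp add: subspace_add)
      moreover have "norm (e (Suc r) - L (e r)) \<le> \<eta> * norm (e r)"
        using step[OF y Ns] by (simp add: e_def next_p next_q y_def[symmetric])
      ultimately show "I (Suc r) \<and> norm (e (Suc r) - L (e r)) \<le> \<eta> * norm (e r)" by blast
    qed
    then have near: "\<And>r. norm (e r) < d" and lim: "e \<longlonglongrightarrow> 0" by auto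
    have "bij_betw (newton_op F V (p r + q r)) V V" if "r \<ge> 1" for r
      using that near[of "r - 1"] bij[of "p r + q r"] by (simp add: e_def N_def)
    moreover have "(\<lambda>r. p r + q r) \<longlonglongrightarrow> z"
    proof (rule LIMSEQ_imp_Suc)
      have "(\<lambda>r. e r + z) \<longlonglongrightarrow> 0 + z" by (intro tendsto_add lim tendsto_const)
      then show "(\<lambda>r. p (Suc r) + q (Suc r)) \<longlonglongrightarrow> z" by (simp add: e_def)
    qed
    ultimately show "(\<forall>r\<ge>1. bij_betw (newton_op F V (p r + q r)) V V)
        \<and> (\<lambda>r. p r + q r) \<longlonglongrightarrow> z" by blast
  qed
qed

section \<open>Smooth functions and Lie derivatives\<close>

lemma Ck_on_Suc_imp: "Ck_on (Suc k) F S \<Longrightarrow> Ck_on k F S"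
proof (induction k arbitrary: F)
  case 0
  then show ?case by (auto intro: differentiable_imp_continuous_on)
next
  case (Suc k)
  then show ?case by (metis Ck_on.simps(2))
qed

lemma Ck_on_imp_continuous_on: "Ck_on k F S \<Longrightarrow> continuous_on S F"
  by (cases k) (auto intro: differentiable_imp_continuous_on)

lemma differentiable_on_openD: "open S \<Longrightarrow> F differentiable_on S \<Longrightarrow> x \<in> S \<Longrightarrow> F differentiable (at x)"
  by (simp add: differentiable_on_eq_differentiable_at)

lemma Ck_on_cong:
  assumes S: "open S"
  shows "(\<And>x. x \<in> S \<Longrightarrow> F x = G x) \<Longrightarrow> Ck_on k F S \<Longrightarrow> Ck_on k G S"
proof (induction k arbitrary: F G)
  case 0
  then show ?case by (simp cong: continuous_on_cong)
next
  case (Suc k)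
  have der: "(G has_derivative frechet_derivative F (at x)) (at x)" if x: "x \<in> S" for x
  proof -
    have "F differentiable (at x)" using Suc.prems S x by (auto intro: differentiable_on_openD)
    then have "(F has_derivative frechet_derivative F (at x)) (at x)"
      by (simp only: frechet_derivative_works)
    then show ?thesis
      by (rule has_derivative_transform_within_open[OF _ S x]) (use Suc.prems in auto)
  qed
  have "Ck_on k (\<lambda>x. frechet_derivative G (at x) v) S" for v
  proof (rule Suc.IH)
    show "Ck_on k (\<lambda>x. frechet_derivative F (at x) v) S" using Suc.prems by simp
    show "frechet_derivative F (at x) v = frechet_derivative G (at x) v" if "x \<in> S" for x
      using frechet_derivative_at[OF der[OF that]] by simp
  qed
  moreover have "G differentiable_on S"
    unfolding differentiable_on_eq_differentiable_at[OF S] using der differentiable_def by blast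
  ultimately show ?case by simp
qed

lemma Ck_on_SucI:
  assumes S: "open S" and D: "\<And>x. x \<in> S \<Longrightarrow> (F has_derivative D x) (at x)"
    and Ck: "\<And>v. Ck_on k (\<lambda>x. D x v) S"
  shows "Ck_on (Suc k) F S"
proof -
  have "F differentiable_on S"
    unfolding differentiable_on_eq_differentiable_at[OF S] using D differentiable_def by blast
  moreover have "Ck_on k (\<lambda>x. frechet_derivative F (at x) v) S" for v
    by (rule Ck_on_cong[OF S _ Ck]) (simp add: frechet_derivative_at[OF D, symmetric])
  ultimately show ?thesis by simp
qed

lemma Ck_on_SucE:
  assumes S: "open S" and Ck: "Ck_on (Suc k) F S"
  shows "x \<in> S \<Longrightarrow> (F has_derivative frechet_derivative F (at x)) (at x)"
    and "Ck_on k (\<lambda>x. frechet_derivative F (at x) v) S"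
  using Ck S by (auto simp: differentiable_on_eq_differentiable_at frechet_derivative_works)

lemma Ck_on_const: "open S \<Longrightarrow> Ck_on k (\<lambda>x. c) S"
proof (induction k arbitrary: c)
  case (Suc k)
  then show ?case by (intro Ck_on_SucI[where D = "\<lambda>_ _. 0"]) auto
qed simp

lemma Ck_on_add: "open S \<Longrightarrow> Ck_on k F S \<Longrightarrow> Ck_on k G S \<Longrightarrow> Ck_on k (\<lambda>x. F x + G x) S"
proof (induction k arbitrary: F G)
  case 0
  then show ?case by (simp add: continuous_on_add)
next
  case (Suc k)
  note S = \<open>open S\<close>
  show ?case
    by (rule Ck_on_SucI[OF S has_derivative_add[OF Ck_on_SucE(1)[OF S Suc.prems(2)]
          Ck_on_SucE(1)[OF S Suc.prems(3)]]])
      (use Suc.IH S Ck_on_SucE(2)[OF S Suc.prems(2)] Ck_on_SucE(2)[OF S Suc.prems(3)] in auto)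
qed

lemma Ck_on_scaleR:
  fixes a :: "'a::euclidean_space \<Rightarrow> real"
  shows "open S \<Longrightarrow> Ck_on k a S \<Longrightarrow> Ck_on k F S \<Longrightarrow> Ck_on k (\<lambda>x. a x *\<^sub>R F x) S"
proof (induction k arbitrary: a F)
  case 0
  then show ?case by (simp add: continuous_on_scaleR)
next
  case (Suc k)
  note S = \<open>open S\<close>
  note a = Ck_on_SucE[OF S Suc.prems(2)] and F = Ck_on_SucE[OF S Suc.prems(3)]
  have "Ck_on k a S" "Ck_on k F S" using Suc.prems Ck_on_Suc_imp by blast+
  then have "Ck_on k (\<lambda>x. a x *\<^sub>R frechet_derivative F (at x) v + frechet_derivative a (at x) v *\<^sub>R F x) S" for v
    by (intro Ck_on_add[OF S] Suc.IH[OF S] a(2) F(2))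
  then show ?case
    by (intro Ck_on_SucI[OF S has_derivative_scaleR[OF a(1) F(1)]])
qed

lemma Ck_on_bounded_linear:
  assumes L: "bounded_linear L"
  shows "open S \<Longrightarrow> Ck_on k F S \<Longrightarrow> Ck_on k (\<lambda>x. L (F x)) S"
proof (induction k arbitrary: F)
  case 0
  then show ?case using L by (simp add: bounded_linear.continuous_on)
next
  case (Suc k)
  note S = \<open>open S\<close>
  note F = Ck_on_SucE[OF S Suc.prems(2)]
  have "Ck_on k (\<lambda>x. L (frechet_derivative F (at x) v)) S" for v
    by (rule Suc.IH[OF S F(2)])
  then show ?case
    by (intro Ck_on_SucI[OF S bounded_linear.has_derivative[OF L F(1)]])
qed

lemma Ck_on_id: "open S \<Longrightarrow> Ck_on k (\<lambda>x. x) S"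
proof (cases k)
  case (Suc j)
  assume S: "open S"
  show ?thesis unfolding Suc
    by (rule Ck_on_SucI[OF S has_derivative_ident Ck_on_const[OF S]])
qed (simp add: continuous_on_id)

lemma smooth_on_linear: "bounded_linear L \<Longrightarrow> open S \<Longrightarrow> smooth_on L S"
  unfolding smooth_on_def using Ck_on_bounded_linear[OF _ _ Ck_on_id] by blast

lemma smooth_on_deriv:
  assumes "open S" "smooth_on F S"
  shows "smooth_on (\<lambda>x. frechet_derivative F (at x) v) S"
  using assms Ck_on_SucE(2) unfolding smooth_on_def by blast

lemma smooth_on_has_derivative:
  assumes "open S" "smooth_on F S" "x \<in> S"
  shows "(F has_derivative frechet_derivative F (at x)) (at x)"
  using assms Ck_on_SucE(1) unfolding smooth_on_def by blast

lemma smooth_on_compose_linear: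
  assumes "bounded_linear L" "open S" "smooth_on F S"
  shows "smooth_on (\<lambda>x. L (F x)) S"
  using assms Ck_on_bounded_linear unfolding smooth_on_def by blast

lemma smooth_on_add: "open S \<Longrightarrow> smooth_on F S \<Longrightarrow> smooth_on G S \<Longrightarrow> smooth_on (\<lambda>x. F x + G x) S"
  using Ck_on_add unfolding smooth_on_def by blast

lemma smooth_on_scaleR:
  fixes a :: "'a::euclidean_space \<Rightarrow> real"
  shows "open S \<Longrightarrow> smooth_on a S \<Longrightarrow> smooth_on F S \<Longrightarrow> smooth_on (\<lambda>x. a x *\<^sub>R F x) S"
  using Ck_on_scaleR unfolding smooth_on_def by blast

lemma smooth_on_sum:
  assumes "open S" "finite I" "\<And>i. i \<in> I \<Longrightarrow> smooth_on (F i) S"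
  shows "smooth_on (\<lambda>x. \<Sum>i\<in>I. F i x) S"
  using assms(2,3)
proof (induction I rule: finite_induct)
  case empty
  then show ?case using Ck_on_const[OF assms(1)] by (auto simp: smooth_on_def)
next
  case (insert i I)
  then show ?case by (simp add: smooth_on_add[OF assms(1)])
qed

lemma smooth_on_cong:
  assumes "open S" "smooth_on F S" "\<And>x. x \<in> S \<Longrightarrow> F x = G x"
  shows "smooth_on G S"
  using assms Ck_on_cong[OF assms(1)] unfolding smooth_on_def by blast

lemma smooth_on_imp_continuous_on: "smooth_on F S \<Longrightarrow> continuous_on S F"
  unfolding smooth_on_def using Ck_on_imp_continuous_on by blast

definition lie :: "('a::euclidean_space \<Rightarrow> 'a) \<Rightarrow> ('a \<Rightarrow> 'b::euclidean_space) \<Rightarrow> 'a \<Rightarrow> 'b" where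
  "lie W G z = frechet_derivative G (at z) (W z)"

lemma lie_eq_sum:
  assumes "open S" "smooth_on G S" "z \<in> S"
  shows "lie W G z = (\<Sum>b\<in>Basis. (W z \<bullet> b) *\<^sub>R frechet_derivative G (at z) b)"
proof -
  have "linear (frechet_derivative G (at z))"
    using smooth_on_has_derivative[OF assms] by (rule has_derivative_linear)
  then have "(\<Sum>b\<in>Basis. (W z \<bullet> b) *\<^sub>R frechet_derivative G (at z) b)
      = frechet_derivative G (at z) (\<Sum>b\<in>Basis. (W z \<bullet> b) *\<^sub>R b)"
    by (simp add: linear_sum linear_scale)
  then show ?thesis by (simp add: lie_def euclidean_representation)
qed

text \<open>
  Expanding the vector field in the standard basis turns the Lie derivative into a finite sum of products of
  smooth functions with derivatives in fixed directions, the only derivatives that the definition of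
  smoothness speaks of.
\<close>

lemma smooth_on_lie:
  assumes S: "open S" and W: "smooth_on W S" and G: "smooth_on G S"
  shows "smooth_on (lie W G) S"
proof (rule smooth_on_cong[OF S])
  show "smooth_on (\<lambda>z. \<Sum>b\<in>Basis. (W z \<bullet> b) *\<^sub>R frechet_derivative G (at z) b) S"
    by (intro smooth_on_sum smooth_on_scaleR S finite_Basis smooth_on_deriv G
        smooth_on_compose_linear[OF bounded_linear_inner_left _ W])
qed (simp add: lie_eq_sum[OF S G])

lemma smooth_on_lie_funpow:
  assumes "open S" "smooth_on W S" "smooth_on G S"
  shows "smooth_on ((lie W ^^ k) G) S"
  using assms by (induction k) (auto intro: smooth_on_lie)

text \<open>
  By the product rule \<open>D(DG(z)(W z)) v = D\<^sup>2G(z)(v, W z) + DG(z)(DW(z) v)\<close>, and the second-order term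
  vanishes at a zero of \<open>W\<close>.
\<close>

lemma lie_deriv_at_zero:
  assumes S: "open S" and W: "smooth_on W S" and G: "smooth_on G S" and z: "z \<in> S" "W z = 0"
  shows "frechet_derivative (lie W G) (at z) v
    = frechet_derivative G (at z) (frechet_derivative W (at z) v)"
proof -
  let ?DG = "\<lambda>x. frechet_derivative G (at x)" and ?DW = "frechet_derivative W (at z)"
  let ?s = "\<lambda>x. \<Sum>b\<in>Basis. (W x \<bullet> b) *\<^sub>R ?DG x b"
  have DW: "(W has_derivative ?DW) (at z)" by (rule smooth_on_has_derivative[OF S W z(1)])
  have DDG: "((\<lambda>x. ?DG x b) has_derivative frechet_derivative (\<lambda>x. ?DG x b) (at z)) (at z)" for b
    by (rule smooth_on_has_derivative[OF S smooth_on_deriv[OF S G] z(1)])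
  have "(?s has_derivative (\<lambda>v. \<Sum>b\<in>Basis. (W z \<bullet> b) *\<^sub>R frechet_derivative (\<lambda>x. ?DG x b) (at z) v
      + (?DW v \<bullet> b) *\<^sub>R ?DG z b)) (at z)"
    by (intro has_derivative_sum has_derivative_scaleR has_derivative_inner_left DW DDG)
  then have "(?s has_derivative (\<lambda>v. \<Sum>b\<in>Basis. (?DW v \<bullet> b) *\<^sub>R ?DG z b)) (at z)"
    using z(2) by simp
  then have "(lie W G has_derivative (\<lambda>v. \<Sum>b\<in>Basis. (?DW v \<bullet> b) *\<^sub>R ?DG z b)) (at z)"
    by (rule has_derivative_transform_within_open[OF _ S z(1)]) (simp add: lie_eq_sum[OF S G])
  then have "frechet_derivative (lie W G) (at z) v = (\<Sum>b\<in>Basis. (?DW v \<bullet> b) *\<^sub>R ?DG z b)"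
    using frechet_derivative_at by metis
  also have "\<dots> = lie (\<lambda>_. ?DW v) G z" using lie_eq_sum[OF S G z(1)] by metis
  finally show ?thesis by (simp add: lie_def)
qed

section \<open>Local existence for smooth vector fields\<close>

text \<open>
  The Picard operator is a contraction on bounded continuous functions on the whole line when its images
  are continued by constants outside \<open>{-\<tau>..\<tau>}\<close>. Integrals start at \<open>-\<tau>\<close> and are corrected by the integral up to \<open>0\<close>, which
  treats both time directions at once. The factor 3 accounts for the lengths \<open>2\<tau>\<close> and \<open>\<tau>\<close> of the two
  intervals of integration.
\<close>

lemma global_lipschitz_ode_solution:
  fixes w :: "'a::euclidean_space \<Rightarrow> 'a"
  assumes L: "0 \<le> L" and lip: "\<And>x y. norm (w x - w y) \<le> L * norm (x - y)"
    and \<tau>: "0 < \<tau>" "3 * \<tau> * L \<le> 1 / 2"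
  shows "\<exists>Z. Z 0 = z\<^sub>0 \<and> (\<forall>t\<in>{-\<tau><..<\<tau>}. (Z has_vector_derivative w (Z t)) (at t))"
proof -
  have "L-lipschitz_on UNIV w"
    using lip L by (intro lipschitz_onI) (auto simp: dist_norm)
  then have cont_w: "continuous_on UNIV w" by (rule lipschitz_on_continuous_on)
  define c where "c t = max (-\<tau>) (min t \<tau>)" for t :: real
  have c_in: "c t \<in> {-\<tau>..\<tau>}" for t using \<tau> by (auto simp: c_def)
  have c_id: "c t = t" if "t \<in> {-\<tau>..\<tau>}" for t using that by (auto simp: c_def)
  have cont_c: "continuous_on UNIV c" unfolding c_def by (intro continuous_intros)
  have cont_wu: "continuous_on S (\<lambda>s. w (apply_bcontfun u s))" for u :: "real \<Rightarrow>\<^sub>C 'a" and S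
    by (rule continuous_on_compose2[OF cont_w]) auto
  have int_wu: "(\<lambda>s. w (apply_bcontfun u s)) integrable_on {a..b}" for u :: "real \<Rightarrow>\<^sub>C 'a" and a b
    by (rule integrable_continuous_real[OF cont_wu])
  define J where "J u t = integral {-\<tau>..t} (\<lambda>s. w (apply_bcontfun u s))" for u :: "real \<Rightarrow>\<^sub>C 'a" and t
  define \<phi> where "\<phi> u t = z\<^sub>0 + (J u (c t) - J u 0)" for u t
  have \<phi>_bcont: "\<phi> u \<in> bcontfun" for u
  proof -
    have cJ: "continuous_on {-\<tau>..\<tau>} (J u)"
      unfolding J_def by (rule indefinite_integral_continuous_1[OF int_wu])
    have "continuous_on UNIV (\<lambda>t. J u (c t))"
      by (rule continuous_on_compose2[OF cJ cont_c]) (use c_in in auto)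
    then have "continuous_on UNIV (\<phi> u)" unfolding \<phi>_def by (intro continuous_intros)
    moreover have "bounded (range (\<phi> u))"
    proof (rule bounded_subset)
      have "continuous_on {-\<tau>..\<tau>} (\<lambda>t. z\<^sub>0 + (J u t - J u 0))" by (intro continuous_intros cJ)
      then show "bounded ((\<lambda>t. z\<^sub>0 + (J u t - J u 0)) ` {-\<tau>..\<tau>})"
        by (intro compact_imp_bounded compact_continuous_image) auto
      show "range (\<phi> u) \<subseteq> (\<lambda>t. z\<^sub>0 + (J u t - J u 0)) ` {-\<tau>..\<tau>}"
        unfolding \<phi>_def using c_in by auto
    qed
    ultimately show ?thesis by (simp add: bcontfun_def)
  qed
  have J_diff: "norm (J u t - J v t) \<le> L * dist u v * (t + \<tau>)" if "-\<tau> \<le> t" for u v t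
  proof -
    have "J u t - J v t
        = integral {-\<tau>..t} (\<lambda>s. w (apply_bcontfun u s) - w (apply_bcontfun v s))"
      unfolding J_def by (rule integral_diff[symmetric, OF int_wu int_wu])
    also have "norm \<dots> \<le> (L * dist u v) * (t - (-\<tau>))"
    proof (rule integral_bound[OF that])
      show "continuous_on {-\<tau>..t} (\<lambda>s. w (apply_bcontfun u s) - w (apply_bcontfun v s))"
        by (intro continuous_on_diff cont_wu)
      show "norm (w (apply_bcontfun u s) - w (apply_bcontfun v s)) \<le> L * dist u v" for s
      proof -
        have "norm (w (apply_bcontfun u s) - w (apply_bcontfun v s))
            \<le> L * dist (apply_bcontfun u s) (apply_bcontfun v s)"
          using lip by (simp add: dist_norm)
        also have "\<dots> \<le> L * dist u v" by (intro mult_left_mono dist_bounded L)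
        finally show ?thesis .
      qed
    qed
    finally show ?thesis by simp
  qed
  have "\<exists>!u. Bcontfun (\<phi> u) = u"
  proof (rule banach_fix_type[of "1/2"])
    show "\<forall>u v. dist (Bcontfun (\<phi> u)) (Bcontfun (\<phi> v)) \<le> 1 / 2 * dist u v"
    proof (intro allI dist_bound)
      fix u v t
      have "dist (\<phi> u t) (\<phi> v t) = norm ((J u (c t) - J v (c t)) - (J u 0 - J v 0))"
        by (simp add: \<phi>_def dist_norm algebra_simps)
      also have "\<dots> \<le> norm (J u (c t) - J v (c t)) + norm (J u 0 - J v 0)"
        by (rule norm_triangle_ineq4)
      also have "\<dots> \<le> L * dist u v * (c t + \<tau>) + L * dist u v * (0 + \<tau>)"
        using c_in[of t] \<tau> by (intro add_mono J_diff) auto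
      also have "\<dots> \<le> L * dist u v * (\<tau> + \<tau>) + L * dist u v * (0 + \<tau>)"
        using c_in[of t] L by (intro add_right_mono mult_left_mono) auto
      also have "\<dots> = (3 * \<tau> * L) * dist u v" by (simp add: algebra_simps)
      also have "\<dots> \<le> 1 / 2 * dist u v" by (intro mult_right_mono \<tau>) auto
      finally show "dist (apply_bcontfun (Bcontfun (\<phi> u)) t) (apply_bcontfun (Bcontfun (\<phi> v)) t)
          \<le> 1 / 2 * dist u v"
        by (simp add: Bcontfun_inverse \<phi>_bcont)
    qed
  qed auto
  then obtain u where "Bcontfun (\<phi> u) = u" by blast
  then have u: "apply_bcontfun u t = \<phi> u t" for t by (metis Bcontfun_inverse \<phi>_bcont)
  show ?thesis
  proof (intro exI[of _ "apply_bcontfun u"] conjI ballI)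
    show "apply_bcontfun u 0 = z\<^sub>0" using \<tau> by (simp add: u \<phi>_def c_id)
    fix t assume t: "t \<in> {-\<tau><..<\<tau>}"
    then have "((\<lambda>t. J u t) has_vector_derivative w (apply_bcontfun u t)) (at t within {-\<tau>..\<tau>})"
      unfolding J_def by (intro integral_has_vector_derivative cont_wu) auto
    then have "(J u has_vector_derivative w (apply_bcontfun u t)) (at t)"
      using t by (simp add: at_within_Icc_at)
    then have "((\<lambda>t. z\<^sub>0 + (J u t - J u 0)) has_vector_derivative w (apply_bcontfun u t)) (at t)"
      by (auto intro!: derivative_eq_intros)
    then show "(apply_bcontfun u has_vector_derivative w (apply_bcontfun u t)) (at t)"
      by (rule has_vector_derivative_transform_within_open[OF _ open_greaterThanLessThan t])
        (simp add: u \<phi>_def c_id)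
  qed
qed

lemma smooth_on_lipschitz_on_ball:
  fixes v :: "'a::euclidean_space \<Rightarrow> 'b::euclidean_space"
  assumes S: "open S" and v: "smooth_on v S" and cb: "cball z r \<subseteq> S"
  obtains L where "0 \<le> L"
    "\<And>x y. x \<in> cball z r \<Longrightarrow> y \<in> cball z r \<Longrightarrow> norm (v x - v y) \<le> L * norm (x - y)"
proof -
  let ?D = "\<lambda>x. frechet_derivative v (at x)"
  let ?n = "\<lambda>x. \<Sum>b\<in>Basis. norm (?D x b)"
  have "continuous_on (cball z r) ?n"
    by (intro continuous_on_sum continuous_on_norm continuous_on_subset[OF _ cb]
        smooth_on_imp_continuous_on smooth_on_deriv[OF S v])
  then have "bounded (?n ` cball z r)"
    by (intro compact_imp_bounded compact_continuous_image) auto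
  then obtain L where L: "L > 0" "\<And>x. x \<in> cball z r \<Longrightarrow> ?n x \<le> L"
    unfolding bounded_pos by (auto simp: abs_le_iff)
  have "norm (v x - v y) \<le> L * norm (x - y)" if x: "x \<in> cball z r" and y: "y \<in> cball z r" for x y
  proof (rule differentiable_bound[OF convex_cball _ _ x y])
    fix x assume x: "x \<in> cball z r"
    have D: "(v has_derivative ?D x) (at x)"
      using smooth_on_has_derivative[OF S v] x cb by blast
    then show "(v has_derivative ?D x) (at x within cball z r)" by (rule has_derivative_at_withinI)
    show "onorm (?D x) \<le> L"
    proof (rule onorm_le)
      fix h
      have "norm (?D x h) \<le> norm h * ?n x"
        by (rule linear_norm_le_sum_Basis[OF has_derivative_linear[OF D]])
      also have "\<dots> \<le> norm h * L" using L(2)[OF x] by (intro mult_left_mono) auto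
      finally show "norm (?D x h) \<le> L * norm h" by (simp add: mult.commute)
    qed
  qed
  with L that show thesis by (meson less_imp_le)
qed

text \<open>
  Composing the field with the nearest-point projection onto a closed ball makes it globally Lipschitz; near
  time zero the solution of the modified equation is still inside the ball.
\<close>

lemma ode_local_existence:
  fixes v :: "'a::euclidean_space \<Rightarrow> 'a"
  assumes S: "open S" and v: "smooth_on v S" and z0: "z\<^sub>0 \<in> S"
  obtains \<tau> Z where "\<tau> > 0" "Z 0 = z\<^sub>0"
    "\<And>t. t \<in> {-\<tau><..<\<tau>} \<Longrightarrow> (Z has_vector_derivative v (Z t)) (at t)"
proof -
  obtain r where r: "r > 0" "cball z\<^sub>0 r \<subseteq> S" using S z0 open_contains_cball by blast
  obtain L where L: "0 \<le> L" and lip: "\<And>x y. x \<in> cball z\<^sub>0 r \<Longrightarrow> y \<in> cball z\<^sub>0 r \<Longrightarrow>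
      norm (v x - v y) \<le> L * norm (x - y)"
    using smooth_on_lipschitz_on_ball[OF S v r(2)] by blast
  define \<pi> where "\<pi> = closest_point (cball z\<^sub>0 r)"
  have \<pi>_in: "\<pi> x \<in> cball z\<^sub>0 r" for x
    unfolding \<pi>_def using r by (intro closest_point_in_set) auto
  have \<pi>_lip: "norm (\<pi> x - \<pi> y) \<le> norm (x - y)" for x y
    unfolding \<pi>_def dist_norm[symmetric] using r by (intro closest_point_lipschitz) auto
  have w_lip: "norm (v (\<pi> x) - v (\<pi> y)) \<le> L * norm (x - y)" for x y
    using lip[OF \<pi>_in \<pi>_in, of x y] mult_left_mono[OF \<pi>_lip L, of x y] by (rule order_trans)
  define T where "T = 1 / (6 * (L + 1))"
  have T: "0 < T" "3 * T * L \<le> 1 / 2" using L by (auto simp: T_def field_simps)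
  from global_lipschitz_ode_solution[OF L w_lip T, of z\<^sub>0]
  obtain Z where Z: "Z 0 = z\<^sub>0"
    "\<And>t. t \<in> {-T<..<T} \<Longrightarrow> (Z has_vector_derivative v (\<pi> (Z t))) (at t)" by blast
  have "isCont Z 0"
    using Z(2)[of 0] T has_vector_derivative_continuous by fastforce
  then obtain d where d: "d > 0" "\<And>t. dist t 0 < d \<Longrightarrow> dist (Z t) z\<^sub>0 < r"
    using r(1) Z(1) unfolding continuous_at_eps_delta dist_norm by (metis diff_zero)
  show thesis
  proof (rule that[of "min T d" Z])
    show "min T d > 0" using T d by simp
    show "Z 0 = z\<^sub>0" by fact
    fix t assume t: "t \<in> {-(min T d)<..<min T d}"
    then have "Z t \<in> cball z\<^sub>0 r" using d(2)[of t] by (auto simp: dist_commute less_imp_le)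
    then have "\<pi> (Z t) = Z t" unfolding \<pi>_def by (rule closest_point_self)
    then show "(Z has_vector_derivative v (Z t)) (at t)" using Z(2)[of t] t by auto
  qed
qed

section \<open>Time derivatives along solutions\<close>

text \<open>
  The system in fast time with the parameter adjoined as a constant variable. It stays smooth at \<open>\<epsilon> = 0\<close>, so
  the singular limit becomes continuity of derivatives at a point of the extended phase space.
\<close>

definition ext_field ::
    "(real^'s \<Rightarrow> real^'f \<Rightarrow> real \<Rightarrow> real^'s) \<Rightarrow> (real^'s \<Rightarrow> real^'f \<Rightarrow> real \<Rightarrow> real^'f) \<Rightarrow>
     (real^'s) \<times> (real^'f) \<times> real \<Rightarrow> (real^'s) \<times> (real^'f) \<times> real" where
  "ext_field f g = (\<lambda>(x, y, \<epsilon>). (\<epsilon> *\<^sub>R f x y \<epsilon>, g x y \<epsilon>, 0))"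

text \<open>
  The \<open>k\<close>-th derivative of the fast component with respect to the fast time \<open>t / \<epsilon>\<close>.
\<close>

definition fast_deriv ::
    "(real^'s \<Rightarrow> real^'f \<Rightarrow> real \<Rightarrow> real^'s) \<Rightarrow> (real^'s \<Rightarrow> real^'f \<Rightarrow> real \<Rightarrow> real^'f) \<Rightarrow>
     nat \<Rightarrow> (real^'s) \<times> (real^'f) \<times> real \<Rightarrow> real^'f" where
  "fast_deriv f g k = (lie (ext_field f g) ^^ k) (\<lambda>z. fst (snd z))"

abbreviation ext_domain :: "real \<Rightarrow> ((real^'s) \<times> (real^'f) \<times> real) set" where
  "ext_domain \<epsilon>\<^sub>1 \<equiv> UNIV \<times> UNIV \<times> {-\<epsilon>\<^sub>1<..<\<epsilon>\<^sub>1}"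

lemma open_ext_domain: "open (ext_domain \<epsilon>\<^sub>1)"
  by (intro open_Times open_UNIV open_greaterThanLessThan)

lemma smooth_ext_field:
  fixes f :: "real^'s \<Rightarrow> real^'f \<Rightarrow> real \<Rightarrow> real^'s"
    and g :: "real^'s \<Rightarrow> real^'f \<Rightarrow> real \<Rightarrow> real^'f"
  assumes "fast_slow_system f g \<epsilon>\<^sub>1"
  shows "smooth_on (ext_field f g) (ext_domain \<epsilon>\<^sub>1)"
proof -
  note S = open_ext_domain[of \<epsilon>\<^sub>1]
  have f: "smooth_on (\<lambda>(x, y, \<epsilon>). f x y \<epsilon>) (ext_domain \<epsilon>\<^sub>1)"
    and g: "smooth_on (\<lambda>(x, y, \<epsilon>). g x y \<epsilon>) (ext_domain \<epsilon>\<^sub>1)"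
    using assms by (auto simp: fast_slow_system_def)
  have e: "smooth_on (\<lambda>z::(real^'s) \<times> (real^'f) \<times> real. snd (snd z)) (ext_domain \<epsilon>\<^sub>1)"
    by (intro smooth_on_linear S bounded_linear_compose[OF bounded_linear_snd bounded_linear_snd])
  have l1: "bounded_linear (\<lambda>a::real^'s. (a, 0::real^'f, 0::real))"
    by (intro bounded_linear_Pair bounded_linear_ident bounded_linear_zero)
  have l2: "bounded_linear (\<lambda>b::real^'f. (0::real^'s, b, 0::real))"
    by (intro bounded_linear_Pair bounded_linear_ident bounded_linear_zero)
  have "smooth_on (\<lambda>z. (snd (snd z) *\<^sub>R (case z of (x, y, \<epsilon>) \<Rightarrow> f x y \<epsilon>), 0, 0::real)
      + (0, (case z of (x, y, \<epsilon>) \<Rightarrow> g x y \<epsilon>), 0)) (ext_domain \<epsilon>\<^sub>1)"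
    by (rule smooth_on_add[OF S smooth_on_compose_linear[OF l1 S smooth_on_scaleR[OF S e f]]
          smooth_on_compose_linear[OF l2 S g]])
  then show ?thesis
    by (rule smooth_on_cong[OF S]) (auto simp: ext_field_def)
qed

lemma smooth_fast_deriv:
  assumes "fast_slow_system f g \<epsilon>\<^sub>1"
  shows "smooth_on (fast_deriv f g k) (ext_domain \<epsilon>\<^sub>1)"
  unfolding fast_deriv_def
  by (intro smooth_on_lie_funpow open_ext_domain smooth_ext_field[OF assms] smooth_on_linear
      bounded_linear_compose[OF bounded_linear_fst bounded_linear_snd])

lemma solution_higher_derivative:
  assumes fs: "fast_slow_system f g \<epsilon>\<^sub>1" and \<epsilon>: "0 < \<epsilon>" "\<epsilon> < \<epsilon>\<^sub>1"
    and sol: "solution_on f g \<epsilon> {-\<tau><..<\<tau>} X Y" and t: "t \<in> {-\<tau><..<\<tau>}"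
  shows "((\<lambda>Z t. vector_derivative Z (at t)) ^^ k) Y t
    = (1 / \<epsilon>) ^ k *\<^sub>R fast_deriv f g k (X t, Y t, \<epsilon>)"
  using t
proof (induction k arbitrary: t)
  case 0
  then show ?case by (simp add: fast_deriv_def)
next
  case (Suc k)
  let ?G = "fast_deriv f g k" and ?Z = "\<lambda>t. (X t, Y t, \<epsilon>)"
  have dom: "?Z t \<in> ext_domain \<epsilon>\<^sub>1" using \<epsilon> by simp
  have X': "(X has_vector_derivative f (X t) (Y t) \<epsilon>) (at t)"
    and Yd: "Y differentiable (at t)" and Y': "\<epsilon> *\<^sub>R vector_derivative Y (at t) = g (X t) (Y t) \<epsilon>"
    using sol Suc.prems by (auto simp: solution_on_def)
  have "vector_derivative Y (at t) = (1 / \<epsilon>) *\<^sub>R g (X t) (Y t) \<epsilon>"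
    using \<epsilon>(1) by (simp add: Y'[symmetric])
  then have Y'': "(Y has_vector_derivative (1 / \<epsilon>) *\<^sub>R g (X t) (Y t) \<epsilon>) (at t)"
    using Yd by (metis vector_derivative_works)
  have Z': "(?Z has_vector_derivative (1 / \<epsilon>) *\<^sub>R ext_field f g (?Z t)) (at t)"
    using has_derivative_Pair[OF X'[unfolded has_vector_derivative_def]
        has_derivative_Pair[OF Y''[unfolded has_vector_derivative_def] has_derivative_const[of \<epsilon>]]] \<epsilon>(1)
    unfolding has_vector_derivative_def by (simp add: ext_field_def)
  have G': "(?G has_derivative frechet_derivative ?G (at (?Z t))) (at (?Z t))"
    by (rule smooth_on_has_derivative[OF open_ext_domain smooth_fast_deriv[OF fs] dom])
  have "((?G \<circ> ?Z) has_vector_derivative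
      frechet_derivative ?G (at (?Z t)) ((1 / \<epsilon>) *\<^sub>R ext_field f g (?Z t))) (at t)"
    by (rule vector_derivative_diff_chain_within[OF Z' has_derivative_at_withinI[OF G']])
  moreover have "frechet_derivative ?G (at (?Z t)) ((1 / \<epsilon>) *\<^sub>R ext_field f g (?Z t))
      = (1 / \<epsilon>) *\<^sub>R fast_deriv f g (Suc k) (?Z t)"
    by (simp add: fast_deriv_def lie_def linear_scale[OF has_derivative_linear[OF G', unfolded fast_deriv_def]])
  ultimately have "((\<lambda>t. (1 / \<epsilon>) ^ k *\<^sub>R ?G (?Z t)) has_vector_derivative
      (1 / \<epsilon>) ^ k *\<^sub>R (1 / \<epsilon>) *\<^sub>R fast_deriv f g (Suc k) (?Z t)) (at t)"
    by (intro bounded_linear.has_vector_derivative[OF bounded_linear_scaleR_right]) (simp add: o_def)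
  then have "(((\<lambda>Z t. vector_derivative Z (at t)) ^^ k) Y has_vector_derivative
      (1 / \<epsilon>) ^ k *\<^sub>R (1 / \<epsilon>) *\<^sub>R fast_deriv f g (Suc k) (?Z t)) (at t)"
    by (rule has_vector_derivative_transform_within_open[OF _ open_greaterThanLessThan Suc.prems])
      (simp add: Suc.IH)
  then show ?case by (simp add: vector_derivative_at mult.commute)
qed

lemma solution_exists:
  assumes fs: "fast_slow_system f g \<epsilon>\<^sub>1" and \<epsilon>: "0 < \<epsilon>" "\<epsilon> < \<epsilon>\<^sub>1"
  shows "\<exists>\<tau>>0. \<exists>X Y. solution_on f g \<epsilon> {-\<tau><..<\<tau>} X Y \<and> X 0 = x\<^sub>0 \<and> Y 0 = y\<^sub>0"
proof -
  have "smooth_on (\<lambda>z. (1 / \<epsilon>) *\<^sub>R ext_field f g z) (ext_domain \<epsilon>\<^sub>1)"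
    by (rule smooth_on_compose_linear[OF bounded_linear_scaleR_right open_ext_domain smooth_ext_field[OF fs]])
  moreover have "(x\<^sub>0, y\<^sub>0, \<epsilon>) \<in> ext_domain \<epsilon>\<^sub>1" using \<epsilon> by simp
  ultimately obtain \<tau> Z where \<tau>: "\<tau> > 0" and Z0: "Z 0 = (x\<^sub>0, y\<^sub>0, \<epsilon>)"
    and Z': "\<And>t. t \<in> {-\<tau><..<\<tau>} \<Longrightarrow> (Z has_vector_derivative (1 / \<epsilon>) *\<^sub>R ext_field f g (Z t)) (at t)"
    using ode_local_existence[OF open_ext_domain] by metis
  define X Y E where "X t = fst (Z t)" and "Y t = fst (snd (Z t))" and "E t = snd (snd (Z t))" for t
  have Z: "Z t = (X t, Y t, E t)" for t by (simp add: X_def Y_def E_def)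
  have comp: "(X has_vector_derivative (1 / \<epsilon>) *\<^sub>R E t *\<^sub>R f (X t) (Y t) (E t)) (at t)"
      "(Y has_vector_derivative (1 / \<epsilon>) *\<^sub>R g (X t) (Y t) (E t)) (at t)"
      "(E has_vector_derivative 0) (at t)" if t: "t \<in> {-\<tau><..<\<tau>}" for t
  proof -
    note D = Z'[OF t]
    note D2 = bounded_linear.has_vector_derivative[OF bounded_linear_snd D]
    show "(X has_vector_derivative (1 / \<epsilon>) *\<^sub>R E t *\<^sub>R f (X t) (Y t) (E t)) (at t)"
      using bounded_linear.has_vector_derivative[OF bounded_linear_fst D]
      by (simp add: ext_field_def X_def[symmetric] Y_def[symmetric] E_def[symmetric] case_prod_unfold)
    show "(Y has_vector_derivative (1 / \<epsilon>) *\<^sub>R g (X t) (Y t) (E t)) (at t)"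
      using bounded_linear.has_vector_derivative[OF bounded_linear_fst D2]
      by (simp add: ext_field_def X_def[symmetric] Y_def[symmetric] E_def[symmetric] case_prod_unfold)
    show "(E has_vector_derivative 0) (at t)"
      using bounded_linear.has_vector_derivative[OF bounded_linear_snd D2]
      by (simp add: ext_field_def X_def[symmetric] Y_def[symmetric] E_def[symmetric] case_prod_unfold)
  qed
  have E: "E t = \<epsilon>" if t: "t \<in> {-\<tau><..<\<tau>}" for t
  proof -
    obtain c where "\<And>s. s \<in> {-\<tau><..<\<tau>} \<Longrightarrow> E s = c"
      using has_vector_derivative_zero_constant[of "{-\<tau><..<\<tau>}" E] comp(3)
        has_vector_derivative_at_within by (metis convex_real_interval(8))
    then have "E t = E 0" using t \<tau> by auto
    then show ?thesis by (simp add: E_def Z0)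
  qed
  have "solution_on f g \<epsilon> {-\<tau><..<\<tau>} X Y"
    unfolding solution_on_def
  proof (intro ballI conjI)
    fix t assume t: "t \<in> {-\<tau><..<\<tau>}"
    show "(X has_vector_derivative f (X t) (Y t) \<epsilon>) (at t)"
      using comp(1)[OF t] E[OF t] \<epsilon>(1) by simp
    show "Y differentiable (at t)" using comp(2)[OF t] by (rule differentiableI_vector)
    show "\<epsilon> *\<^sub>R vector_derivative Y (at t) = g (X t) (Y t) \<epsilon>"
      using vector_derivative_at[OF comp(2)[OF t]] E[OF t] \<epsilon>(1) by simp
  qed
  moreover have "X 0 = x\<^sub>0" "Y 0 = y\<^sub>0" by (simp_all add: X_def Y_def Z0)
  ultimately show ?thesis using \<tau> by blast
qed

text \<open>
  The chain rule computes the derivative for every solution, and a solution through each point exists; so the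
  definite description in the definition picks a genuine value, smooth in \<open>y\<^sub>0\<close>.
\<close>

lemma time_derivative_eq:
  assumes fs: "fast_slow_system f g \<epsilon>\<^sub>1" and \<epsilon>: "0 < \<epsilon>" "\<epsilon> < \<epsilon>\<^sub>1"
  shows "time_derivative f g \<epsilon> k x\<^sub>0 y\<^sub>0 = (1 / \<epsilon>) ^ k *\<^sub>R fast_deriv f g k (x\<^sub>0, y\<^sub>0, \<epsilon>)"
proof -
  have val: "((\<lambda>Z t. vector_derivative Z (at t)) ^^ k) Y 0 = (1 / \<epsilon>) ^ k *\<^sub>R fast_deriv f g k (x\<^sub>0, y\<^sub>0, \<epsilon>)"
    if "\<tau> > 0" "solution_on f g \<epsilon> {-\<tau><..<\<tau>} X Y" "X 0 = x\<^sub>0" "Y 0 = y\<^sub>0" for \<tau> X Y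
    using solution_higher_derivative[OF fs \<epsilon> that(2), of 0 k] that by simp
  show ?thesis
    unfolding time_derivative_def
  proof (rule the_equality)
    obtain \<tau> X Y where sol: "\<tau> > 0" "solution_on f g \<epsilon> {-\<tau><..<\<tau>} X Y" "X 0 = x\<^sub>0" "Y 0 = y\<^sub>0"
      using solution_exists[OF fs \<epsilon>] by blast
    show "\<exists>\<tau>>0. \<exists>X Y. solution_on f g \<epsilon> {-\<tau><..<\<tau>} X Y \<and> X 0 = x\<^sub>0 \<and> Y 0 = y\<^sub>0 \<and>
        (1 / \<epsilon>) ^ k *\<^sub>R fast_deriv f g k (x\<^sub>0, y\<^sub>0, \<epsilon>)
          = ((\<lambda>Z t. vector_derivative Z (at t)) ^^ k) Y 0"
      using sol val[OF sol, symmetric] by blast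
  qed (use val in auto)
qed

text \<open>
  At \<open>\<epsilon> = 0\<close> the slow variables are constant and the critical point is an equilibrium of the fast equation
  \<open>y' = g x\<^sub>0 y 0\<close>, whose linearization multiplies by the Jacobian \<open>B\<close> of \<open>g\<close>. Each Lie derivative
  therefore contributes one factor \<open>B\<close>.
\<close>

lemma fast_deriv_at_critical_point:
  fixes f :: "real^'s \<Rightarrow> real^'f \<Rightarrow> real \<Rightarrow> real^'s"
    and g :: "real^'s \<Rightarrow> real^'f \<Rightarrow> real \<Rightarrow> real^'f"
  assumes fs: "fast_slow_system f g \<epsilon>\<^sub>1" and crit: "g x\<^sub>0 y\<^sub>0 0 = 0"
  shows "frechet_derivative (fast_deriv f g k) (at (x\<^sub>0, y\<^sub>0, 0)) (0, \<eta>, 0)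
    = ((*v) (jacobian (\<lambda>y. g x\<^sub>0 y 0) (at y\<^sub>0)) ^^ k) \<eta>"
proof (induction k arbitrary: \<eta>)
  case 0
  have "bounded_linear (\<lambda>z::(real^'s) \<times> (real^'f) \<times> real. fst (snd z))"
    by (rule bounded_linear_compose[OF bounded_linear_fst bounded_linear_snd])
  from frechet_derivative_at[OF bounded_linear_imp_has_derivative[OF this]]
  show ?case by (simp add: fast_deriv_def)
next
  case (Suc k)
  let ?S = "ext_domain \<epsilon>\<^sub>1 :: ((real^'s) \<times> (real^'f) \<times> real) set"
  let ?z = "(x\<^sub>0, y\<^sub>0, 0::real)" and ?B = "jacobian (\<lambda>y. g x\<^sub>0 y 0) (at y\<^sub>0)" and ?W = "ext_field f g"
  let ?f = "\<lambda>(x, y, \<epsilon>). f x y \<epsilon>" and ?g = "\<lambda>(x, y, \<epsilon>). g x y \<epsilon>"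
  have z: "?z \<in> ?S" using fs by (simp add: fast_slow_system_def)
  have W0: "?W ?z = 0" using crit by (simp add: ext_field_def zero_prod_def)
  have sf: "smooth_on ?f ?S" and sg: "smooth_on ?g ?S" using fs by (auto simp: fast_slow_system_def)
  have f': "(?f has_derivative frechet_derivative ?f (at ?z)) (at ?z)"
    by (rule smooth_on_has_derivative[OF open_ext_domain sf z])
  have g': "(?g has_derivative frechet_derivative ?g (at ?z)) (at ?z)"
    by (rule smooth_on_has_derivative[OF open_ext_domain sg z])
  have "((\<lambda>y. (x\<^sub>0, y, 0::real)) has_derivative (\<lambda>h. (0, h, 0))) (at y\<^sub>0)"
    by (intro has_derivative_Pair has_derivative_const has_derivative_ident)
  from has_derivative_compose[OF this g']
  have gy: "((\<lambda>y. g x\<^sub>0 y 0) has_derivative (\<lambda>h. frechet_derivative ?g (at ?z) (0, h, 0))) (at y\<^sub>0)"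
    by simp
  have "((\<lambda>y. g x\<^sub>0 y 0) has_derivative (\<lambda>h. ?B *v h)) (at y\<^sub>0)"
    using gy jacobian_works differentiable_def by blast
  from has_derivative_unique[OF gy this]
  have Dg: "frechet_derivative ?g (at ?z) (0, h, 0) = ?B *v h" for h by metis
  have e': "((\<lambda>z::(real^'s) \<times> (real^'f) \<times> real. snd (snd z)) has_derivative (\<lambda>z. snd (snd z))) (at ?z)"
    by (intro derivative_intros)
  have "((\<lambda>z. (snd (snd z) *\<^sub>R ?f z, ?g z, 0::real)) has_derivative
      (\<lambda>h. (snd (snd ?z) *\<^sub>R frechet_derivative ?f (at ?z) h + snd (snd h) *\<^sub>R ?f ?z,
        frechet_derivative ?g (at ?z) h, 0))) (at ?z)"
    by (intro has_derivative_Pair has_derivative_scaleR e' f' g' has_derivative_const)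
  moreover have "(\<lambda>z. (snd (snd z) *\<^sub>R ?f z, ?g z, 0::real)) = ?W"
    by (auto simp: ext_field_def fun_eq_iff)
  ultimately have "(?W has_derivative
      (\<lambda>h. (snd (snd ?z) *\<^sub>R frechet_derivative ?f (at ?z) h + snd (snd h) *\<^sub>R ?f ?z,
        frechet_derivative ?g (at ?z) h, 0))) (at ?z)" by simp
  from fun_cong[OF frechet_derivative_at[OF this], of "(0, \<eta>, 0)"]
  have DW: "frechet_derivative ?W (at ?z) (0, \<eta>, 0) = (0, ?B *v \<eta>, 0)"
    by (simp add: Dg)
  have "frechet_derivative (fast_deriv f g (Suc k)) (at ?z) (0, \<eta>, 0)
      = frechet_derivative (lie ?W (fast_deriv f g k)) (at ?z) (0, \<eta>, 0)"
    by (simp add: fast_deriv_def)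
  also have "\<dots> = frechet_derivative (fast_deriv f g k) (at ?z) (frechet_derivative ?W (at ?z) (0, \<eta>, 0))"
    by (rule lie_deriv_at_zero[OF open_ext_domain smooth_ext_field[OF fs] smooth_fast_deriv[OF fs] z W0])
  also have "\<dots> = ((*v) ?B ^^ k) (?B *v \<eta>)" unfolding DW by (rule Suc.IH)
  finally show ?case by (simp add: funpow_swap1)
qed

lemma bigo_power_tendsto_zero:
  fixes a :: "real \<Rightarrow> 'a::real_normed_vector"
  assumes "(\<lambda>\<epsilon>. norm (a \<epsilon>)) \<in> O[at_right 0](\<lambda>\<epsilon>. \<epsilon> ^ (n + 1))"
  shows "(a \<longlongrightarrow> 0) (at_right 0)"
proof -
  obtain c where "\<forall>\<^sub>F \<epsilon> in at_right 0. norm (norm (a \<epsilon>)) \<le> c * norm (\<epsilon> ^ (n + 1))"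
    using landau_o.bigE[OF assms] by blast
  then have bound: "\<forall>\<^sub>F \<epsilon> in at_right 0. norm (a \<epsilon>) \<le> c * norm (\<epsilon> ^ (n + 1))" by simp
  have "((\<lambda>\<epsilon>::real. c * norm (\<epsilon> ^ (n + 1))) \<longlongrightarrow> c * norm ((0::real) ^ (n + 1))) (at_right 0)"
    by (intro tendsto_intros)
  then have "((\<lambda>\<epsilon>::real. c * norm (\<epsilon> ^ (n + 1))) \<longlongrightarrow> 0) (at_right 0)" by simp
  from Lim_null_comparison[OF bound this] show ?thesis .
qed

lemma Fmap_has_derivative:
  assumes fs: "fast_slow_system f g \<epsilon>\<^sub>1" and \<epsilon>: "0 < \<epsilon>" "\<epsilon> < \<epsilon>\<^sub>1"
  shows "(Fmap f g \<epsilon> H m x\<^sub>0 has_derivative (\<lambda>\<eta>. \<eta> - (- H / \<epsilon>) ^ (m + 1) *\<^sub>R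
    frechet_derivative (fast_deriv f g (m + 1)) (at (x\<^sub>0, y, \<epsilon>)) (0, \<eta>, 0))) (at y)"
proof -
  let ?G = "fast_deriv f g (m + 1)" and ?k = "(- H / \<epsilon>) ^ (m + 1)"
  have "(- H) ^ (m + 1) * (1 / \<epsilon>) ^ (m + 1) = ?k"
    unfolding power_mult_distrib[symmetric] by simp
  then have F: "Fmap f g \<epsilon> H m x\<^sub>0 = (\<lambda>y. y - ?k *\<^sub>R ?G (x\<^sub>0, y, \<epsilon>))"
    by (simp only: fun_eq_iff Fmap_def time_derivative_eq[OF fs \<epsilon>] scaleR_scaleR) simp
  have "(x\<^sub>0, y, \<epsilon>) \<in> ext_domain \<epsilon>\<^sub>1" using \<epsilon> by simp
  then have G': "(?G has_derivative frechet_derivative ?G (at (x\<^sub>0, y, \<epsilon>))) (at (x\<^sub>0, y, \<epsilon>))"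
    by (rule smooth_on_has_derivative[OF open_ext_domain smooth_fast_deriv[OF fs]])
  have "((\<lambda>y. (x\<^sub>0, y, \<epsilon>)) has_derivative (\<lambda>h. (0, h, 0))) (at y)"
    by (intro has_derivative_Pair has_derivative_const has_derivative_ident)
  from has_derivative_compose[OF this G'] show ?thesis
    unfolding F
    by (intro has_derivative_diff has_derivative_ident has_derivative_scaleR_right)
qed

lemma jacobian_mult_eq:
  fixes F :: "real^'n \<Rightarrow> real^'m"
  assumes "(F has_derivative D) (at y)"
  shows "jacobian F (at y) *v h = D h"
proof -
  have "(F has_derivative (\<lambda>h. jacobian F (at y) *v h)) (at y)"
    using assms jacobian_works differentiable_def by blast
  from has_derivative_unique[OF this assms] show ?thesis by metis
qed

section \<open>Convergence to the fixed point\<close>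

theorem mainTheorem6:
  fixes f :: "real^'s \<Rightarrow> real^'f \<Rightarrow> real \<Rightarrow> real^'s"
    and g :: "real^'s \<Rightarrow> real^'f \<Rightarrow> real \<Rightarrow> real^'f"
    and \<epsilon>\<^sub>1 :: real
    and K :: "(real^'s) set"
    and h :: "real \<Rightarrow> real^'s \<Rightarrow> real^'f"
    and hc :: "nat \<Rightarrow> real^'s \<Rightarrow> real^'f"
    and x\<^sub>0 :: "real^'s"
    and m :: nat
    and H :: "real \<Rightarrow> real"
    and hm :: "real \<Rightarrow> real^'f"
  assumes "fast_slow_system f g \<epsilon>\<^sub>1"
    and "slow_manifold f g \<epsilon>\<^sub>1 K h hc"
    and "normally_attracting g K (hc 0)"
    and "x\<^sub>0 \<in> K"
    and "m \<ge> 1"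
    and "\<forall>\<epsilon>\<in>{0<..<\<epsilon>\<^sub>1}. H \<epsilon> > 0"
    and "H \<in> O[at_right 0](\<lambda>\<epsilon>. \<epsilon>)"
    and "\<forall>\<^sub>F \<epsilon> in at_right 0. hm \<epsilon> isolated_in {y. Fmap f g \<epsilon> (H \<epsilon>) m x\<^sub>0 y = y}"
    and "(\<lambda>\<epsilon>. norm (hm \<epsilon> - h \<epsilon> x\<^sub>0)) \<in> O[at_right 0](\<lambda>\<epsilon>. \<epsilon> ^ (m + 1))"
  shows "\<forall>\<^sub>F \<epsilon> in at_right 0.
    (let F = Fmap f g \<epsilon> (H \<epsilon>) m x\<^sub>0; J = jacobian F (at (hm \<epsilon>)) in
     \<forall>\<delta> M \<mu> V.
       0 < \<delta> \<and> \<delta> < 1 \<and> M \<le> CARD('f) \<and> spectrum_enum J \<mu> \<and>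
       (\<forall>i\<in>{1..M}. \<mu> i \<notin> ball 0 (1 - \<delta>)) \<and>
       (\<forall>i\<in>{M+1..CARD('f)}. \<mu> i \<in> ball 0 (1 - \<delta>)) \<and>
       maximal_invariant_subspace J (\<mu> ` {1..M}) V \<longrightarrow>
       (\<exists>\<rho>>0. \<forall>y\<^sub>1\<in>ball (hm \<epsilon>) \<rho>. \<forall>p q.
          newton_picard_iteration F V y\<^sub>1 p q \<longrightarrow>
            (\<forall>r\<ge>1. bij_betw (newton_op F V (p r + q r)) V V) \<and>
            (\<lambda>r. p r + q r) \<longlonglongrightarrow> hm \<epsilon>))"
proof -
  note fs = assms(1)
  have \<epsilon>1: "\<epsilon>\<^sub>1 > 0" using fs by (simp add: fast_slow_system_def)
  let ?S = "ext_domain \<epsilon>\<^sub>1 :: ((real^'s) \<times> (real^'f) \<times> real) set"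
  define h0 where "h0 = hc 0 x\<^sub>0"
  have crit: "g x\<^sub>0 h0 0 = 0" using assms(2,4) by (simp add: slow_manifold_def h0_def)
  define D where "D z \<eta> = frechet_derivative (fast_deriv f g (m + 1)) (at z) (0, \<eta>, 0)"
    for z :: "(real^'s) \<times> (real^'f) \<times> real" and \<eta> :: "real^'f"
  have D_cont: "continuous_on ?S (\<lambda>z. D z \<eta>)" for \<eta>
    unfolding D_def
    by (intro smooth_on_imp_continuous_on smooth_on_deriv open_ext_domain smooth_fast_deriv[OF fs])
  have D_lin: "linear (D z)" if "z \<in> ?S" for z
  proof -
    have "bounded_linear (frechet_derivative (fast_deriv f g (m + 1)) (at z))"
      using smooth_on_has_derivative[OF open_ext_domain smooth_fast_deriv[OF fs] that]
      by (rule has_derivative_bounded_linear)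
    moreover have "bounded_linear (\<lambda>\<eta>::real^'f. (0::real^'s, \<eta>, 0::real))"
      by (intro bounded_linear_Pair bounded_linear_ident bounded_linear_zero)
    ultimately have "bounded_linear (D z)" unfolding D_def by (rule bounded_linear_compose)
    then show ?thesis by (rule bounded_linear.linear)
  qed

  \<comment> \<open>The determinant condition on the critical set makes \<open>B\<^bsup>m+1\<^esup>\<close> injective, hence bounded below by
    some \<open>c\<close>; for small \<open>\<epsilon>\<close> this survives at \<open>hm \<epsilon>\<close>, which tends to \<open>h0\<close>.\<close>
  let ?B = "jacobian (\<lambda>y. g x\<^sub>0 y 0) (at h0)"
  let ?z0 = "(x\<^sub>0, h0, 0::real)"
  have z0: "?z0 \<in> ?S" using \<epsilon>1 by simp
  have "inj ((*v) ?B)"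
    using fs crit by (simp add: fast_slow_system_def inj_matrix_vector_mult invertible_det_nz)
  then have "inj (((*v) ?B) ^^ k)" for k by (rule inj_fn)
  moreover have "D ?z0 = ((*v) ?B) ^^ (m + 1)"
    unfolding D_def fast_deriv_at_critical_point[OF fs crit] ..
  ultimately have "inj (D ?z0)" by metis
  from linear_inj_bounded_below_pos[OF D_lin[OF z0] this]
  obtain c where c: "c > 0" "\<And>\<eta>. c * norm \<eta> \<le> norm (D ?z0 \<eta>)" by metis

  have "((\<lambda>\<epsilon>. hm \<epsilon> - h \<epsilon> x\<^sub>0) \<longlongrightarrow> 0) (at_right 0)"
    by (rule bigo_power_tendsto_zero[OF assms(9)])
  moreover have "(\<lambda>\<epsilon>. norm (h \<epsilon> x\<^sub>0 - h0)) \<in> O[at_right 0](\<lambda>\<epsilon>. \<epsilon> ^ (0 + 1))"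
  proof -
    have "(\<lambda>\<epsilon>. norm (h \<epsilon> x\<^sub>0 - (\<Sum>i\<le>0. \<epsilon> ^ i *\<^sub>R hc i x\<^sub>0))) \<in> O[at_right 0](\<lambda>\<epsilon>. \<epsilon> ^ (0 + 1))"
      using assms(2,4) unfolding slow_manifold_def by blast
    then show ?thesis by (simp add: h0_def)
  qed
  then have "((\<lambda>\<epsilon>. h \<epsilon> x\<^sub>0 - h0) \<longlongrightarrow> 0) (at_right 0)" by (rule bigo_power_tendsto_zero)
  ultimately have "((\<lambda>\<epsilon>. (hm \<epsilon> - h \<epsilon> x\<^sub>0) + (h \<epsilon> x\<^sub>0 - h0) + h0) \<longlongrightarrow> 0 + 0 + h0) (at_right 0)"
    by (intro tendsto_add tendsto_const)
  then have hm_lim: "(hm \<longlongrightarrow> h0) (at_right 0)" by simp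
  have z_lim: "((\<lambda>\<epsilon>. (x\<^sub>0, hm \<epsilon>, \<epsilon>)) \<longlongrightarrow> ?z0) (at_right 0)"
    by (intro tendsto_Pair tendsto_const hm_lim tendsto_ident_at)
  have D_lim: "((\<lambda>\<epsilon>. D (x\<^sub>0, hm \<epsilon>, \<epsilon>) \<eta>) \<longlongrightarrow> D ?z0 \<eta>) (at_right 0)" for \<eta>
  proof -
    have "isCont (\<lambda>z. D z \<eta>) ?z0"
      using D_cont z0 open_ext_domain continuous_on_eq_continuous_at by metis
    then show ?thesis using z_lim by (rule isCont_tendsto_compose)
  qed
  have "((\<lambda>\<epsilon>. \<Sum>b\<in>Basis. norm (D ?z0 b - D (x\<^sub>0, hm \<epsilon>, \<epsilon>) b)) \<longlongrightarrow>
      (\<Sum>b\<in>(Basis::(real^'f) set). norm (D ?z0 b - D ?z0 b))) (at_right 0)"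
    by (intro tendsto_sum tendsto_norm tendsto_diff tendsto_const D_lim)
  then have "((\<lambda>\<epsilon>. \<Sum>b\<in>(Basis::(real^'f) set). norm (D ?z0 b - D (x\<^sub>0, hm \<epsilon>, \<epsilon>) b)) \<longlongrightarrow> 0) (at_right 0)"
    by simp
  then have ev_close: "\<forall>\<^sub>F \<epsilon> in at_right 0.
      (\<Sum>b\<in>(Basis::(real^'f) set). norm (D ?z0 b - D (x\<^sub>0, hm \<epsilon>, \<epsilon>) b)) < c"
    using c(1) by (rule order_tendstoD(2))
  have ev_range: "\<forall>\<^sub>F \<epsilon> in at_right 0. \<epsilon> \<in> {0<..<\<epsilon>\<^sub>1}"
    by (rule eventually_at_right_real[OF \<epsilon>1])
  show ?thesis
    using ev_close ev_range assms(8)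
  proof eventually_elim
    case (elim \<epsilon>)
    define F where "F = Fmap f g \<epsilon> (H \<epsilon>) m x\<^sub>0"
    define J where "J = jacobian F (at (hm \<epsilon>))"
    have \<epsilon>: "0 < \<epsilon>" "\<epsilon> < \<epsilon>\<^sub>1" using elim by auto
    have dom: "(x\<^sub>0, y, \<epsilon>) \<in> ?S" for y using \<epsilon> by simp
    have fixpt: "F (hm \<epsilon>) = hm \<epsilon>" using elim(3) by (simp add: isolated_in_def F_def)
    define \<kappa> where "\<kappa> = (- H \<epsilon> / \<epsilon>) ^ (m + 1)"
    have "H \<epsilon> > 0" using assms(6) \<epsilon> by simp
    then have \<kappa>: "\<kappa> \<noteq> 0" using \<epsilon> by (simp add: \<kappa>_def)
    have F': "(F has_derivative (\<lambda>\<eta>. \<eta> - \<kappa> *\<^sub>R D (x\<^sub>0, y, \<epsilon>) \<eta>)) (at y)" for y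
      unfolding F_def \<kappa>_def D_def by (rule Fmap_has_derivative[OF fs \<epsilon>])
    have jac: "jacobian F (at y) *v \<eta> = \<eta> - \<kappa> *\<^sub>R D (x\<^sub>0, y, \<epsilon>) \<eta>" for y \<eta>
      by (rule jacobian_mult_eq[OF F'])
    have diff: "F differentiable (at (hm \<epsilon>))" using F' differentiable_def by blast
    have cont: "((\<lambda>y. jacobian F (at y) *v b) \<longlongrightarrow> J *v b) (nhds (hm \<epsilon>))" for b
    proof -
      have "isCont (\<lambda>z. D z b) (x\<^sub>0, hm \<epsilon>, \<epsilon>)"
        using D_cont dom open_ext_domain continuous_on_eq_continuous_at by metis
      moreover have "((\<lambda>y. (x\<^sub>0, y, \<epsilon>)) \<longlongrightarrow> (x\<^sub>0, hm \<epsilon>, \<epsilon>)) (nhds (hm \<epsilon>))"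
        by (intro tendsto_Pair tendsto_const filterlim_ident)
      ultimately have "((\<lambda>y. D (x\<^sub>0, y, \<epsilon>) b) \<longlongrightarrow> D (x\<^sub>0, hm \<epsilon>, \<epsilon>) b) (nhds (hm \<epsilon>))"
        by (rule isCont_tendsto_compose)
      then show ?thesis unfolding J_def jac by (intro tendsto_diff tendsto_scaleR tendsto_const)
    qed
    have regular: "v = 0" if "J *v v = v" for v
    proof (rule ccontr)
      assume "v \<noteq> 0"
      have "D (x\<^sub>0, hm \<epsilon>, \<epsilon>) v = 0" using that \<kappa> by (simp add: J_def jac)
      then have "c * norm v \<le> norm (D ?z0 v - D (x\<^sub>0, hm \<epsilon>, \<epsilon>) v)" using c(2)[of v] by simp
      also have "\<dots> \<le> norm v * (\<Sum>b\<in>Basis. norm (D ?z0 b - D (x\<^sub>0, hm \<epsilon>, \<epsilon>) b))"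
        by (intro linear_norm_le_sum_Basis linear_compose_sub D_lin dom z0)
      also have "\<dots> < norm v * c" using elim(1) \<open>v \<noteq> 0\<close> by (intro mult_strict_left_mono) auto
      finally show False by simp
    qed
    show ?case
      unfolding Let_def F_def[symmetric] J_def[symmetric]
    proof (intro allI impI)
      fix \<delta> M \<mu> V
      assume a: "0 < \<delta> \<and> \<delta> < 1 \<and> M \<le> CARD('f) \<and> spectrum_enum J \<mu> \<and>
        (\<forall>i\<in>{1..M}. \<mu> i \<notin> ball 0 (1 - \<delta>)) \<and>
        (\<forall>i\<in>{M+1..CARD('f)}. \<mu> i \<in> ball 0 (1 - \<delta>)) \<and>
        maximal_invariant_subspace J (\<mu> ` {1..M}) V"
      then have V: "subspace V" and inv: "\<And>v. v \<in> V \<Longrightarrow> J *v v \<in> V"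
        by (auto simp: maximal_invariant_subspace_def invariant_subspace_for_def)
      have inner: "cmod (\<mu> i) < 1 - \<delta>" if "i \<in> {M+1..CARD('f)}" for i
      proof -
        have "\<mu> i \<in> ball 0 (1 - \<delta>)" using a that by blast
        then show ?thesis by simp
      qed
      have pow: "(\<lambda>k. ((\<lambda>x. (J *v (x - orth_projection V x))
        - orth_projection V (J *v (x - orth_projection V x))) ^^ k) x) \<longlonglongrightarrow> 0" for x
        using a inner by (intro compression_powers_tendsto_zero[of J \<mu> M "1 - \<delta>" V x]) auto
      show "\<exists>\<rho>>0. \<forall>y\<^sub>1\<in>ball (hm \<epsilon>) \<rho>. \<forall>p q.
          newton_picard_iteration F V y\<^sub>1 p q \<longrightarrow>
            (\<forall>r\<ge>1. bij_betw (newton_op F V (p r + q r)) V V) \<and>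
            (\<lambda>r. p r + q r) \<longlonglongrightarrow> hm \<epsilon>"
        by (rule newton_picard_converges[OF V, of F "hm \<epsilon>", folded J_def,
            OF inv fixpt diff cont regular pow])
    qed
  qed
qed

end
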